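(* Let $(W,S)$ be a Coxeter system, $(Q,\phi)$ a maximal distinguished matching on $W$, $a=\phi(e)$, $w\in Q$ and $s\in S$. If $s\ne a$ and for all $v\le w$ with $v\in P_s$ one has $\phi(sv)=s\phi(v)$, then $\phi(sw)=s\phi(w)$. If $s=a$ and for all $v\le w$ with $v\in P$ one has $\phi(sv)=s\phi(v)$, then $\phi(sw)=s\phi(w)$. The analogous statements with $s$ acting on the right (i.e. with $\phi(vs)=\phi(v)s$ and $\phi(ws)=\phi(w)s$ in place of $\phi(sv)=s\phi(v)$ and $\phi(sw)=s\phi(w)$) also hold.
   Context: $W$ carries the Bruhat order $\le$ and the length function; $e$ is the identity; $x\lhd y$ means that $y$ covers $x$; $\mathrm{coat}(y)=\{x : x\lhd y\}$. A subset $Q\subseteq W$ is decreasing if $q\in Q$ and $x\le q$ imply $x\in Q$. A partial distinguished matching of $W$ is a pair $(Q,\phi)$ with $Q\subseteq W$ decreasing and $\phi:Q\to Q$ such that: (i) $\phi(\phi(u))=u$ for all $u$; (ii) for all $u\in Q$, $u\lhd\phi(u)$ or $\phi(u)\lhd u$; (iii) for all $u\in Q$ with $u\lhd\phi(u)$, $\mathrm{coat}(\phi(u))=\{u\}\cup\{\phi(v): v\lhd u,\ v\lhd\phi(v)\}$. It is maximal if it is maximal for the order: $(Q_1,\phi_1)\le(Q_2,\phi_2)$ iff $Q_1\subseteq Q_2$ and $\phi_2$ extends $\phi_1$. One has $\phi(e)\in S$. $P_s=\langle s,a\rangle$ for $s\in S\setminus\{a\}$ and $P=\bigcup_{s\in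 S\setminus\{a\}}P_s$. An equality "$\phi(x)=y$" includes the assertion that $\phi$ is defined at $x$ (i.e. $x\in Q$). *)

theory Defs
  imports "HOL-Algebra.Algebra"
begin

definition word_prod :: "('a, 'b) monoid_scheme \<Rightarrow> 'a list \<Rightarrow> 'a" where
  "word_prod W xs = foldr (\<lambda>x y. x \<otimes>\<^bsub>W\<^esub> y) xs \<one>\<^bsub>W\<^esub>"

text \<open>The relator \<open>(st)^m(s,t)\<close>, where \<open>m(s,t)\<close> is the order of \<open>st\<close> in \<open>W\<close>. The library's
  \<open>ord\<close> is 0 on elements of infinite order, which then contribute only the trivial relator \<open>[]\<close>.
  For \<open>s = t\<close> the relator is \<open>[s, s]\<close>.\<close>

definition coxeter_relator :: "('a, 'b) monoid_scheme \<Rightarrow> 'a \<Rightarrow> 'a \<Rightarrow> 'a list" where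
  "coxeter_relator W s t = concat (replicate (group.ord W (s \<otimes>\<^bsub>W\<^esub> t)) [s, t])"

definition relator_insertion ::
    "('a, 'b) monoid_scheme \<Rightarrow> 'a set \<Rightarrow> ('a list \<times> 'a list) set" where
  "relator_insertion W S =
     {(xs @ ys, xs @ coxeter_relator W s t @ ys) | xs ys s t.
        xs \<in> lists S \<and> ys \<in> lists S \<and> s \<in> S \<and> t \<in> S}"

definition word_equiv ::
    "('a, 'b) monoid_scheme \<Rightarrow> 'a set \<Rightarrow> ('a list \<times> 'a list) set" where
  "word_equiv W S = (relator_insertion W S \<union> (relator_insertion W S)\<inverse>)\<^sup>*"

text \<open>The last conjunct says that the generators \<open>S\<close> and the relations \<open>(st)^m(s,t) = 1\<close>
  (for \<open>m(s,t)\<close> finite) present \<open>W\<close>. Words without formal inverses suffice, because the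
  relators \<open>[s, s]\<close> make each generator its own inverse. \<open>S\<close> may be infinite.\<close>

definition coxeter_system :: "('a, 'b) monoid_scheme \<Rightarrow> 'a set \<Rightarrow> bool" where
  "coxeter_system W S \<longleftrightarrow>
     group W \<and> S \<subseteq> carrier W \<and> (\<forall>s\<in>S. group.ord W s = 2) \<and> generate W S = carrier W \<and>
     (\<forall>xs\<in>lists S. \<forall>ys\<in>lists S.
        word_prod W xs = word_prod W ys \<longleftrightarrow> (xs, ys) \<in> word_equiv W S)"

definition cox_length :: "('a, 'b) monoid_scheme \<Rightarrow> 'a set \<Rightarrow> 'a \<Rightarrow> nat" where
  "cox_length W S w = (LEAST n. \<exists>xs\<in>lists S. length xs = n \<and> word_prod W xs = w)"

definition reflections :: "('a, 'b) monoid_scheme \<Rightarrow> 'a set \<Rightarrow> 'a set" where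
  "reflections W S = {w \<otimes>\<^bsub>W\<^esub> s \<otimes>\<^bsub>W\<^esub> inv\<^bsub>W\<^esub> w | w s. w \<in> carrier W \<and> s \<in> S}"

definition bruhat_step :: "('a, 'b) monoid_scheme \<Rightarrow> 'a set \<Rightarrow> ('a \<times> 'a) set" where
  "bruhat_step W S =
     {(u, u \<otimes>\<^bsub>W\<^esub> t) | u t. u \<in> carrier W \<and> t \<in> reflections W S \<and>
        cox_length W S u < cox_length W S (u \<otimes>\<^bsub>W\<^esub> t)}"

definition bruhat_le :: "('a, 'b) monoid_scheme \<Rightarrow> 'a set \<Rightarrow> 'a \<Rightarrow> 'a \<Rightarrow> bool" where
  "bruhat_le W S x y \<longleftrightarrow> x \<in> carrier W \<and> y \<in> carrier W \<and> (x, y) \<in> (bruhat_step W S)\<^sup>*"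

definition bruhat_less :: "('a, 'b) monoid_scheme \<Rightarrow> 'a set \<Rightarrow> 'a \<Rightarrow> 'a \<Rightarrow> bool" where
  "bruhat_less W S x y \<longleftrightarrow> bruhat_le W S x y \<and> x \<noteq> y"

definition covered_by :: "('a, 'b) monoid_scheme \<Rightarrow> 'a set \<Rightarrow> 'a \<Rightarrow> 'a \<Rightarrow> bool" where
  "covered_by W S x y \<longleftrightarrow>
     bruhat_less W S x y \<and> \<not> (\<exists>z. bruhat_less W S x z \<and> bruhat_less W S z y)"

definition coat :: "('a, 'b) monoid_scheme \<Rightarrow> 'a set \<Rightarrow> 'a \<Rightarrow> 'a set" where
  "coat W S y = {x. covered_by W S x y}"

definition decreasing :: "('a, 'b) monoid_scheme \<Rightarrow> 'a set \<Rightarrow> 'a set \<Rightarrow> bool" where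
  "decreasing W S Q \<longleftrightarrow>
     Q \<subseteq> carrier W \<and> (\<forall>q x. q \<in> Q \<longrightarrow> bruhat_le W S x q \<longrightarrow> x \<in> Q)"

text \<open>A map \<open>Q \<rightarrow> Q\<close> is given by a total function of which only the values on \<open>Q\<close> matter.\<close>

definition partial_distinguished_matching ::
    "('a, 'b) monoid_scheme \<Rightarrow> 'a set \<Rightarrow> 'a set \<Rightarrow> ('a \<Rightarrow> 'a) \<Rightarrow> bool" where
  "partial_distinguished_matching W S Q \<phi> \<longleftrightarrow>
     decreasing W S Q \<and> \<phi> \<in> Q \<rightarrow> Q \<and>
     (\<forall>u\<in>Q. \<phi> (\<phi> u) = u) \<and>
     (\<forall>u\<in>Q. covered_by W S u (\<phi> u) \<or> covered_by W S (\<phi> u) u) \<and>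
     (\<forall>u\<in>Q. covered_by W S u (\<phi> u) \<longrightarrow>
        coat W S (\<phi> u) = {u} \<union> {\<phi> v | v. covered_by W S v u \<and> covered_by W S v (\<phi> v)})"

definition matching_le ::
    "'a set \<Rightarrow> ('a \<Rightarrow> 'a) \<Rightarrow> 'a set \<Rightarrow> ('a \<Rightarrow> 'a) \<Rightarrow> bool" where
  "matching_le Q1 \<phi>1 Q2 \<phi>2 \<longleftrightarrow> Q1 \<subseteq> Q2 \<and> (\<forall>u\<in>Q1. \<phi>2 u = \<phi>1 u)"

definition maximal_distinguished_matching ::
    "('a, 'b) monoid_scheme \<Rightarrow> 'a set \<Rightarrow> 'a set \<Rightarrow> ('a \<Rightarrow> 'a) \<Rightarrow> bool" where
  "maximal_distinguished_matching W S Q \<phi> \<longleftrightarrow>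
     partial_distinguished_matching W S Q \<phi> \<and>
     (\<forall>Q' \<phi>'. partial_distinguished_matching W S Q' \<phi>' \<and> matching_le Q \<phi> Q' \<phi>' \<longrightarrow>
        matching_le Q' \<phi>' Q \<phi>)"

definition dihedral :: "('a, 'b) monoid_scheme \<Rightarrow> 'a \<Rightarrow> 'a \<Rightarrow> 'a set" where
  "dihedral W a s = generate W {s, a}"

definition dihedral_union :: "('a, 'b) monoid_scheme \<Rightarrow> 'a set \<Rightarrow> 'a \<Rightarrow> 'a set" where
  "dihedral_union W S a = (\<Union>s\<in>S - {a}. dihedral W a s)"

end

(* Induct on the length of w. If s w < w, phi(w) < w or phi(w) = s w, the claim for w follows from
   the claim for a coatom of w or from phi being an involution. Otherwise s phi(w) covers both
   phi(w) and s w, and the claim for the coatoms of w shows that coat(s phi(w)) is what the third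
   axiom prescribes for phi(s w). So if s w were not in Q, the matching would extend by the pair
   s w, s phi(w), against maximality; and if s w is in Q, then phi(s w) and s phi(w) have the same
   coatoms. Elements with the same coatoms are equal unless they lie in a common dihedral parabolic
   subgroup, which then contains w and phi(e) and so is one where commutation is assumed. *)
theory Submission
  imports Defs
begin

section \<open>Length and inversions\<close>

text \<open>The obstacle is that axiom (iii) prescribes only the coatoms of \<phi>(u), and coatoms
  do not determine an element: in a dihedral group, distinct elements of equal positive length have
  the same coatoms. The hypothesis on dihedral subgroups resolves this ambiguity. It applies because
  standard parabolic subgroups are decreasing and w < \<phi>(w) implies \<phi>(e) \<le> \<phi>(w): a
  dihedral parabolic subgroup containing s \<phi>(w) contains w and \<phi>(e) as well, and
  \<phi>(e), being a generator, is one of its two generators. The induction has no separate base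
  case, since e has no coatoms. The right-handed statements are the left-handed ones for the
  matching that sends x to the inverse of \<phi>(x^-1). All facts on length and Bruhat order are
  drawn from the presentation through one invariant, the parity with which a word crosses a
  reflection; its independence of the word yields strong exchange.\<close>

locale coxeter_group = group W for W :: "('a, 'b) monoid_scheme" (structure) +
  fixes S :: "'a set"
  assumes coxeter: "coxeter_system W S"
begin

abbreviation len :: "'a \<Rightarrow> nat" where "len \<equiv> cox_length W S"
abbreviation wp :: "'a list \<Rightarrow> 'a" where "wp \<equiv> word_prod W"

lemma inv_cancel [simp]:
  assumes "x \<in> carrier W" "y \<in> carrier W"
  shows "inv x \<otimes> (x \<otimes> y) = y" "x \<otimes> (inv x \<otimes> y) = y"
  using assms by (simp_all add: m_assoc [symmetric])

lemma gens_closed: "S \<subseteq> carrier W"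
  using coxeter by (simp add: coxeter_system_def)

lemma gen_closed [simp]: "s \<in> S \<Longrightarrow> s \<in> carrier W"
  using gens_closed by blast

lemma gen_sq [simp]: assumes "s \<in> S" shows "s \<otimes> s = \<one>"
proof -
  have "s \<in> carrier W" "ord s = 2" using assms coxeter by (auto simp: coxeter_system_def)
  then have "s [^] (2 :: nat) = \<one>" using pow_ord_eq_1 [of s] by simp
  then show ?thesis using assms by (simp add: numeral_2_eq_2)
qed

lemma gen_cancel [simp]: "\<lbrakk>s \<in> S; x \<in> carrier W\<rbrakk> \<Longrightarrow> s \<otimes> (s \<otimes> x) = x"
  by (simp add: m_assoc [symmetric])

lemma gen_inv [simp]: "s \<in> S \<Longrightarrow> inv s = s"
  by (simp add: inv_equality)

lemma gen_not_one: "s \<in> S \<Longrightarrow> s \<noteq> \<one>"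
  using coxeter by (auto simp: coxeter_system_def)

section \<open>Words in the generators and their length\<close>

lemma wp_Nil [simp]: "wp [] = \<one>"
  and wp_Cons [simp]: "wp (x # xs) = x \<otimes> wp xs"
  by (simp_all add: word_prod_def)

lemma wp_closed [simp]: "set xs \<subseteq> carrier W \<Longrightarrow> wp xs \<in> carrier W"
  by (induction xs) auto

lemma wp_gens_closed [simp]: "set xs \<subseteq> S \<Longrightarrow> wp xs \<in> carrier W"
  using gens_closed by (meson order_trans wp_closed)

lemma wp_append [simp]:
  "\<lbrakk>set xs \<subseteq> carrier W; set ys \<subseteq> carrier W\<rbrakk> \<Longrightarrow> wp (xs @ ys) = wp xs \<otimes> wp ys"
  by (induction xs) (auto simp: m_assoc)

lemma wp_rev: "set xs \<subseteq> S \<Longrightarrow> wp (rev xs) = inv (wp xs)"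
proof (induction xs)
  case (Cons x xs)
  then have "set xs \<subseteq> carrier W" using gens_closed by auto
  with Cons show ?case by (simp add: inv_mult_group)
qed simp

text \<open>Each generator is its own inverse, so closing \<open>J\<close> under inversion adds no
  letters.\<close>

lemma generate_eq_words: assumes "J \<subseteq> S" shows "generate W J = wp ` lists J"
proof
  show "generate W J \<subseteq> wp ` lists J"
  proof
    fix x assume "x \<in> generate W J"
    then show "x \<in> wp ` lists J"
    proof (induction rule: generate.induct)
      case one show ?case by (auto intro!: image_eqI [of _ _ "[]"])
    next
      case (incl h) with assms show ?case by (auto intro!: image_eqI [of _ _ "[h]"])
    next
      case (inv h) with assms show ?case by (auto intro!: image_eqI [of _ _ "[h]"])
    next
      case (eng h1 h2)
      then obtain xs ys where "xs \<in> lists J" "ys \<in> lists J" "h1 = wp xs" "h2 = wp ys" by blast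
      moreover have "J \<subseteq> carrier W" using assms gens_closed by blast
      ultimately show ?case
        by (intro image_eqI [of _ _ "xs @ ys"]) (auto simp: lists_eq_set)
    qed
  qed
  have "wp xs \<in> generate W J" if "set xs \<subseteq> J" for xs
    using that by (induction xs) (auto intro: generate.intros)
  then show "wp ` lists J \<subseteq> generate W J" by (auto simp: lists_eq_set)
qed

lemma word_exists: assumes "w \<in> carrier W" obtains xs where "set xs \<subseteq> S" "wp xs = w"
proof -
  have "w \<in> wp ` lists S"
    using assms coxeter generate_eq_words [of S] by (simp add: coxeter_system_def)
  then show ?thesis using that by (auto simp: lists_eq_set)
qed

lemma reduced_word: assumes "w \<in> carrier W"
  obtains xs where "set xs \<subseteq> S" "wp xs = w" "length xs = len w"
proof -
  obtain xs where xs: "set xs \<subseteq> S" "wp xs = w" by (rule word_exists [OF assms])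
  then have "\<exists>n. \<exists>xs\<in>lists S. length xs = n \<and> wp xs = w" by (auto simp: lists_eq_set)
  then have "\<exists>xs\<in>lists S. length xs = len w \<and> wp xs = w"
    unfolding cox_length_def by (rule LeastI_ex)
  then show ?thesis using that by (auto simp: lists_eq_set)
qed

lemma len_le: "set xs \<subseteq> S \<Longrightarrow> len (wp xs) \<le> length xs"
  unfolding cox_length_def by (rule Least_le) (auto simp: lists_eq_set)

lemma len_one [simp]: "len \<one> = 0"
  using len_le [of "[]"] by simp

lemma len_eq_0: "w \<in> carrier W \<Longrightarrow> len w = 0 \<longleftrightarrow> w = \<one>"
  by (metis len_one length_0_conv reduced_word wp_Nil)

lemma len_inv [simp]: assumes "w \<in> carrier W" shows "len (inv w) = len w"
proof -
  have le: "len (inv v) \<le> len v" if v: "v \<in> carrier W" for v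
  proof -
    obtain xs where "set xs \<subseteq> S" "wp xs = v" "length xs = len v"
      by (rule reduced_word [OF v])
    then show ?thesis using len_le [of "rev xs"] by (simp add: wp_rev)
  qed
  show ?thesis using le [OF assms] le [of "inv w"] assms by simp
qed

lemma len_gen_mult_le: assumes "s \<in> S" "w \<in> carrier W" shows "len (s \<otimes> w) \<le> Suc (len w)"
proof -
  obtain xs where "set xs \<subseteq> S" "wp xs = w" "length xs = len w"
    by (rule reduced_word [OF assms(2)])
  then show ?thesis using len_le [of "s # xs"] assms(1) by simp
qed

text \<open>The parity of the number of prefixes \<open>p @ [s]\<close> of the word with \<open>t = p s p\<^sup>-\<^sup>1\<close>. It is
  invariant under insertion of relators, hence a function of the value of the word.\<close>

primrec crosses :: "'a list \<Rightarrow> 'a \<Rightarrow> bool" where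
  "crosses [] t \<longleftrightarrow> False"
| "crosses (s # xs) t \<longleftrightarrow> (t = s) \<noteq> crosses xs (s \<otimes> t \<otimes> s)"

text \<open>The suffix sees t conjugated by the value of the prefix already read.\<close>

lemma crosses_append:
  assumes "set xs \<subseteq> S" "t \<in> carrier W"
  shows "crosses (xs @ ys) t \<longleftrightarrow> crosses xs t \<noteq> crosses ys (inv (wp xs) \<otimes> t \<otimes> wp xs)"
  using assms
proof (induction xs arbitrary: t)
  case (Cons s xs)
  then have "inv (wp (s # xs)) \<otimes> t \<otimes> wp (s # xs) = inv (wp xs) \<otimes> (s \<otimes> t \<otimes> s) \<otimes> wp xs"
    by (simp add: inv_mult_group m_assoc)
  with Cons show ?case by auto
qed simp

lemma wp_alternating:
  "s \<in> S \<Longrightarrow> t \<in> S \<Longrightarrow> wp (concat (replicate n [s, t])) = (s \<otimes> t) [^] n"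
proof (induction n)
  case (Suc n)
  then have "wp (concat (replicate (Suc n) [s, t])) = (s \<otimes> t) \<otimes> (s \<otimes> t) [^] n"
    by (simp add: m_assoc)
  then show ?case using Suc.prems nat_pow_Suc2 [of "s \<otimes> t" n] by simp
qed simp

text \<open>The reflection read off at position j of the word stst... is
  \<open>(s \<otimes> t) [^] j \<otimes> s\<close>, and n blocks have 2n positions.\<close>

lemma crosses_alternating:
  assumes "s \<in> S" "t \<in> S" "u \<in> carrier W"
  shows "crosses (concat (replicate n [s, t])) u \<longleftrightarrow>
    odd (\<Sum>j<2 * n. of_bool (u = (s \<otimes> t) [^] j \<otimes> s) :: nat)"
proof (induction n)
  case (Suc n)
  define c where "c = s \<otimes> t"
  have c [simp]: "c \<in> carrier W" using assms by (simp add: c_def)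
  \<comment> \<open>Conjugation by s inverts the rotation c.\<close>
  have sc: "s \<otimes> c [^] k = inv (c [^] k) \<otimes> s" for k :: nat
  proof (induction k)
    case (Suc k)
    have "s \<otimes> c [^] Suc k = s \<otimes> c [^] k \<otimes> c" using assms by (simp add: m_assoc)
    also have "\<dots> = inv (c [^] k) \<otimes> (s \<otimes> c)" using Suc assms by (simp add: m_assoc)
    also have "s \<otimes> c = inv c \<otimes> s"
      using assms by (simp add: c_def inv_mult_group m_assoc)
    also have "inv (c [^] k) \<otimes> (inv c \<otimes> s) = inv (c [^] Suc k) \<otimes> s"
      using assms nat_pow_Suc2 [of c k] by (simp add: inv_mult_group m_assoc)
    finally show ?case .
  qed (use assms in simp)
  have cs: "s \<otimes> inv (c [^] n) = c [^] n \<otimes> s"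
  proof -
    have "c [^] n \<otimes> s = c [^] n \<otimes> (s \<otimes> c [^] n) \<otimes> inv (c [^] n)"
      using assms by (simp add: m_assoc)
    then show ?thesis using assms by (simp add: sc m_assoc)
  qed
  define v where "v = inv (c [^] n) \<otimes> u \<otimes> c [^] n"
  have conj: "v = x \<longleftrightarrow> u = c [^] n \<otimes> x \<otimes> inv (c [^] n)" if "x \<in> carrier W" for x
    unfolding v_def using that assms by (auto simp: m_assoc)
  \<comment> \<open>The appended block [s, t] contributes positions 2n and 2n + 1, whose reflections
    are s and sts conjugated by \<open>c [^] n\<close>.\<close>
  have s_eq: "v = s \<longleftrightarrow> u = c [^] (2 * n) \<otimes> s"
  proof -
    have "c [^] n \<otimes> s \<otimes> inv (c [^] n) = c [^] n \<otimes> c [^] n \<otimes> s"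
      using cs assms by (simp add: m_assoc)
    then show ?thesis using conj [of s] assms by (simp add: nat_pow_mult mult_2)
  qed
  have t_eq: "s \<otimes> v \<otimes> s = t \<longleftrightarrow> u = c [^] (Suc (2 * n)) \<otimes> s"
  proof -
    have vc: "v \<in> carrier W" using assms by (simp add: v_def)
    have "s \<otimes> v \<otimes> s = t \<longleftrightarrow> v = c \<otimes> s"
    proof
      assume "s \<otimes> v \<otimes> s = t"
      then have "c \<otimes> s = s \<otimes> (s \<otimes> v \<otimes> s) \<otimes> s" by (simp add: c_def)
      then show "v = c \<otimes> s" using assms vc by (simp add: m_assoc)
    next
      assume "v = c \<otimes> s" then show "s \<otimes> v \<otimes> s = t" using assms by (simp add: c_def m_assoc)
    qed
    moreover have "c [^] n \<otimes> (c \<otimes> s) \<otimes> inv (c [^] n) = c [^] Suc (2 * n) \<otimes> s"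
    proof -
      have "c [^] n \<otimes> (c \<otimes> s) \<otimes> inv (c [^] n) = c [^] n \<otimes> c \<otimes> c [^] n \<otimes> s"
        using cs assms by (simp add: m_assoc)
      also have "c [^] n \<otimes> c \<otimes> c [^] n = c [^] (Suc n + n)"
        by (metis c nat_pow_Suc nat_pow_mult)
      finally show ?thesis by (simp add: mult_2)
    qed
    ultimately show ?thesis using conj [of "c \<otimes> s"] assms by simp
  qed
  have set: "set (concat (replicate n [s, t])) \<subseteq> S" using assms by auto
  have "concat (replicate (Suc n) [s, t]) = concat (replicate n [s, t]) @ [s, t]"
    by (metis append_Nil2 concat.simps concat_append replicate_Suc replicate_append_same)
  then have "crosses (concat (replicate (Suc n) [s, t])) u \<longleftrightarrow>
      crosses (concat (replicate n [s, t])) u \<noteq> ((v = s) \<noteq> (s \<otimes> v \<otimes> s = t))"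
    using crosses_append [OF set assms(3), of "[s, t]"] assms wp_alternating [of s t n]
    by (auto simp: v_def c_def)
  then show ?case using Suc s_eq t_eq by (auto simp: c_def)
qed simp

text \<open>The powers of st have period m, so positions j and m + j read off the same reflection
  and everything is counted twice. For infinite order m is 0 and the relator is empty.\<close>

lemma crosses_relator:
  assumes "s \<in> S" "t \<in> S" "u \<in> carrier W"
  shows "\<not> crosses (coxeter_relator W s t) u"
proof -
  define m where "m = ord (s \<otimes> t)"
  have period: "(s \<otimes> t) [^] (m + j) = (s \<otimes> t) [^] j" for j
    using assms by (simp add: m_def nat_pow_mult [symmetric])
  let ?f = "\<lambda>j. of_bool (u = (s \<otimes> t) [^] j \<otimes> s) :: nat"
  have "(\<Sum>j<m + k. ?f j) = (\<Sum>j<m. ?f j) + (\<Sum>j<k. ?f j)" for k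
    by (induction k) (auto simp: period)
  from this [of m] have "even (\<Sum>j<2 * m. ?f j)" by (simp add: mult_2)
  then show ?thesis
    using crosses_alternating [OF assms] by (simp add: coxeter_relator_def m_def)
qed

lemma wp_relator: "s \<in> S \<Longrightarrow> t \<in> S \<Longrightarrow> wp (coxeter_relator W s t) = \<one>"
  by (simp add: coxeter_relator_def wp_alternating)

text \<open>The relator has value 1 and even parity everywhere, so the suffix behind it sees the
  same element as before.\<close>

lemma crosses_insertion:
  assumes "(xs, ys) \<in> relator_insertion W S" "u \<in> carrier W"
  shows "crosses xs u \<longleftrightarrow> crosses ys u"
proof -
  obtain ps qs s t where eq: "xs = ps @ qs" "ys = ps @ coxeter_relator W s t @ qs"
    and mem: "ps \<in> lists S" "s \<in> S" "t \<in> S"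
    using assms(1) by (auto simp: relator_insertion_def)
  have sub: "set ps \<subseteq> S" using mem by (simp add: lists_eq_set)
  define v where "v = inv (wp ps) \<otimes> u \<otimes> wp ps"
  have v: "v \<in> carrier W" using sub assms(2) by (simp add: v_def)
  have "set (coxeter_relator W s t) \<subseteq> S" using mem by (auto simp: coxeter_relator_def)
  from crosses_append [OF this v, of qs] have "crosses (coxeter_relator W s t @ qs) v = crosses qs v"
    using mem v crosses_relator [OF mem(2,3) v] by (simp add: wp_relator)
  then show ?thesis by (simp add: eq crosses_append [OF sub assms(2)] v_def)
qed

text \<open>Here the presentation of W enters: words of equal value are linked by insertions and
  deletions of relators.\<close>

lemma crosses_cong:
  assumes "set xs \<subseteq> S" "set ys \<subseteq> S" "wp xs = wp ys" "u \<in> carrier W"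
  shows "crosses xs u \<longleftrightarrow> crosses ys u"
proof -
  have "(xs, ys) \<in> word_equiv W S"
    using assms coxeter by (auto simp: coxeter_system_def lists_eq_set)
  then show ?thesis unfolding word_equiv_def
    by (induction rule: rtrancl_induct) (auto dest: crosses_insertion [OF _ assms(4)])
qed

text \<open>By \<open>crosses_cong\<close> every word for w gives the same answer. For a reflection
  t it means that tw is shorter than w (\<open>inversion_iff\<close>), so these are the left
  inversions of w.\<close>

definition inversion :: "'a \<Rightarrow> 'a \<Rightarrow> bool" where
  "inversion w t \<longleftrightarrow> (\<exists>xs. set xs \<subseteq> S \<and> wp xs = w \<and> crosses xs t)"

lemma inversion_wp: "\<lbrakk>set xs \<subseteq> S; t \<in> carrier W\<rbrakk> \<Longrightarrow> inversion (wp xs) t \<longleftrightarrow> crosses xs t"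
  unfolding inversion_def using crosses_cong by blast

text \<open>The cocycle rule N(xy) = N(x) + x N(y) x^-1 for inversion sets, with symmetric
  difference as sum.\<close>

lemma inversion_mult:
  assumes "x \<in> carrier W" "y \<in> carrier W" "t \<in> carrier W"
  shows "inversion (x \<otimes> y) t \<longleftrightarrow> inversion x t \<noteq> inversion y (inv x \<otimes> t \<otimes> x)"
proof -
  obtain xs where xs: "set xs \<subseteq> S" "wp xs = x" by (rule word_exists [OF assms(1)])
  obtain ys where ys: "set ys \<subseteq> S" "wp ys = y" by (rule word_exists [OF assms(2)])
  have "wp (xs @ ys) = x \<otimes> y" using xs ys gens_closed by (subst wp_append) auto
  then have "inversion (x \<otimes> y) t \<longleftrightarrow> crosses (xs @ ys) t"
    using xs ys assms(3) inversion_wp [of "xs @ ys"] by auto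
  then show ?thesis
    using xs ys assms inversion_wp [of xs t] inversion_wp [of ys "inv x \<otimes> t \<otimes> x"]
    by (simp add: crosses_append)
qed

lemma inversion_gen: "\<lbrakk>s \<in> S; t \<in> carrier W\<rbrakk> \<Longrightarrow> inversion s t \<longleftrightarrow> t = s"
  using inversion_wp [of "[s]" t] by simp

lemma inversion_one: "t \<in> carrier W \<Longrightarrow> \<not> inversion \<one> t"
  using inversion_wp [of "[]" t] by simp

text \<open>Strong exchange: odd parity forces some position to read off t, and deleting the letter
  there multiplies the value by t. Stated for arbitrary words, it can later be applied to words over
  a subset of S.\<close>

lemma crosses_deletion:
  assumes "set xs \<subseteq> S" "t \<in> carrier W" "crosses xs t"
  shows "\<exists>ys. set ys \<subseteq> set xs \<and> Suc (length ys) = length xs \<and> wp ys = t \<otimes> wp xs"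
  using assms
proof (induction xs arbitrary: t)
  case (Cons s xs)
  show ?case
  proof (cases "t = s")
    case True
    then show ?thesis using Cons by (intro exI [of _ xs]) auto
  next
    case False
    then have "crosses xs (s \<otimes> t \<otimes> s)" "s \<otimes> t \<otimes> s \<in> carrier W" "set xs \<subseteq> S"
      using Cons.prems by auto
    from Cons.IH [OF this(3,2,1)] obtain ys where ys: "set ys \<subseteq> set xs"
      "Suc (length ys) = length xs" "wp ys = s \<otimes> t \<otimes> s \<otimes> wp xs" by blast
    have "wp (s # ys) = t \<otimes> wp (s # xs)" using Cons.prems ys(3) by (simp add: m_assoc)
    then show ?thesis using ys(1,2) by (intro exI [of _ "s # ys"]) auto
  qed
qed simp

section \<open>Reflections as inversions, and the resulting rules for length\<close>

lemma reflection_closed: "t \<in> reflections W S \<Longrightarrow> t \<in> carrier W"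
  by (auto simp: reflections_def)

lemma gen_reflection: assumes "s \<in> S" shows "s \<in> reflections W S"
  unfolding reflections_def using assms by (auto intro!: exI [of _ "\<one>"] exI [of _ s])

lemma conj_reflection:
  assumes "t \<in> reflections W S" "x \<in> carrier W"
  shows "x \<otimes> t \<otimes> inv x \<in> reflections W S"
proof -
  obtain w s where t: "t = w \<otimes> s \<otimes> inv w" "w \<in> carrier W" "s \<in> S"
    using assms(1) by (auto simp: reflections_def)
  have "x \<otimes> t \<otimes> inv x = (x \<otimes> w) \<otimes> s \<otimes> inv (x \<otimes> w)"
    using t assms by (simp add: m_assoc inv_mult_group)
  moreover have "x \<otimes> w \<in> carrier W" using t(2) assms(2) by simp
  ultimately show ?thesis unfolding reflections_def using t(3) by blast
qed

lemma reflection_sq: assumes "t \<in> reflections W S" shows "t \<otimes> t = \<one>"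
proof -
  obtain w s where t: "t = w \<otimes> s \<otimes> inv w" "w \<in> carrier W" "s \<in> S"
    using assms by (auto simp: reflections_def)
  have "t \<otimes> t = w \<otimes> (s \<otimes> ((inv w \<otimes> w) \<otimes> (s \<otimes> inv w)))"
    using t(2,3) by (simp only: t(1) m_assoc m_closed inv_closed gen_closed)
  then show ?thesis using t(2,3) by simp
qed

text \<open>Apply the cocycle rule to t = w s w^-1. The outer factors contribute equally, because w
  w^-1 = 1 has no inversions, so only the middle s counts.\<close>

lemma inversion_reflection: assumes "t \<in> reflections W S" shows "inversion t t"
proof -
  obtain w s where t: "t = w \<otimes> s \<otimes> inv w" "w \<in> carrier W" "s \<in> S"
    using assms by (auto simp: reflections_def)
  have tc: "t \<in> carrier W" using t by simp
  have conj: "inv w \<otimes> t \<otimes> w = s" using t by (simp add: m_assoc)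
  have "\<not> inversion (w \<otimes> inv w) t" using t tc by (simp add: inversion_one)
  then have 1: "inversion w t \<longleftrightarrow> inversion (inv w) s"
    using inversion_mult [of w "inv w" t] t tc conj by simp
  have "inversion t t \<longleftrightarrow> inversion w t \<noteq> inversion (s \<otimes> inv w) s"
    using inversion_mult [of w "s \<otimes> inv w" t] t tc conj by (simp add: m_assoc)
  also have "inversion (s \<otimes> inv w) s \<longleftrightarrow> \<not> inversion (inv w) s"
    using inversion_mult [of s "inv w" s] t by (simp add: inversion_gen)
  finally show ?thesis using 1 by simp
qed

lemma inversion_len_less:
  assumes "inversion w t" "w \<in> carrier W" "t \<in> carrier W"
  shows "len (t \<otimes> w) < len w"
proof -
  obtain xs where xs: "set xs \<subseteq> S" "wp xs = w" "length xs = len w"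
    by (rule reduced_word [OF assms(2)])
  then obtain ys where "set ys \<subseteq> S" "Suc (length ys) = length xs" "wp ys = t \<otimes> w"
    using crosses_deletion [of xs t] inversion_wp [of xs t] assms by auto
  then show ?thesis using len_le [of ys] xs by simp
qed

text \<open>If t is not an inversion of w, it is one of tw, because t is an inversion of itself;
  hence either w or tw is strictly shorter.\<close>

lemma inversion_iff:
  assumes "t \<in> reflections W S" "w \<in> carrier W"
  shows "inversion w t \<longleftrightarrow> len (t \<otimes> w) < len w"
    and not_inversion_iff: "\<not> inversion w t \<longleftrightarrow> len w < len (t \<otimes> w)"
proof -
  have tc: "t \<in> carrier W" using assms reflection_closed by blast
  have "inversion (t \<otimes> w) t" if "\<not> inversion w t"
  proof -
    have "inv t \<otimes> t \<otimes> t = t" using tc by simp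
    then show ?thesis using inversion_mult [of t w t] tc assms that by (simp add: inversion_reflection)
  qed
  moreover have "t \<otimes> (t \<otimes> w) = w"
    using reflection_sq [OF assms(1)] tc assms(2) by (simp add: m_assoc [symmetric])
  ultimately have up: "len w < len (t \<otimes> w)" if "\<not> inversion w t"
    using that inversion_len_less [of "t \<otimes> w" t] tc assms(2) by simp
  show "inversion w t \<longleftrightarrow> len (t \<otimes> w) < len w" "\<not> inversion w t \<longleftrightarrow> len w < len (t \<otimes> w)"
    using up inversion_len_less [OF _ assms(2) tc] by fastforce+
qed

lemma len_gen [simp]: assumes "s \<in> S" shows "len s = 1"
  using len_gen_mult_le [of s \<one>] assms len_eq_0 [of s] gen_not_one [of s] by fastforce

lemma len_gen_mult:
  assumes "s \<in> S" "w \<in> carrier W"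
  shows "len (s \<otimes> w) = Suc (len w) \<or> len w = Suc (len (s \<otimes> w))"
proof -
  \<comment> \<open>The dichotomy of \<open>inversion_iff\<close> leaves no room for equal
    lengths.\<close>
  have "len (s \<otimes> w) \<noteq> len w"
    using inversion_iff [of s w] not_inversion_iff [of s w] assms gen_reflection by auto
  moreover have "len (s \<otimes> w) \<le> Suc (len w)" "len w \<le> Suc (len (s \<otimes> w))"
    using len_gen_mult_le [of s w] len_gen_mult_le [of s "s \<otimes> w"] assms by auto
  ultimately show ?thesis by linarith
qed

text \<open>The lifting properties of the Bruhat order all come from this equivalence.\<close>

lemma len_reflection_gen_mult:
  assumes "t \<in> reflections W S" "s \<in> S" "t \<noteq> s" "y \<in> carrier W"
  shows "len (s \<otimes> t \<otimes> y) < len (s \<otimes> y) \<longleftrightarrow> len (t \<otimes> y) < len y"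
proof -
  have tc: "t \<in> carrier W" using assms reflection_closed by blast
  let ?t = "s \<otimes> t \<otimes> s"
  have refl: "?t \<in> reflections W S" using conj_reflection [of t s] assms by simp
  have "s \<otimes> ?t \<otimes> s = t" using assms tc by (simp add: m_assoc)
  moreover have "?t \<noteq> s" using assms(2,3) calculation by auto
  ultimately have "inversion (s \<otimes> y) ?t \<longleftrightarrow> inversion y t"
    using inversion_mult [of s y ?t] assms tc by (simp add: inversion_gen)
  moreover have "?t \<otimes> (s \<otimes> y) = s \<otimes> t \<otimes> y" using assms tc by (simp add: m_assoc)
  ultimately show ?thesis
    using inversion_iff [OF refl, of "s \<otimes> y"] inversion_iff [OF assms(1,4)] assms by simp
qed

lemma left_descent_exists:
  assumes "w \<in> carrier W" "w \<noteq> \<one>" obtains s where "s \<in> S" "len w = Suc (len (s \<otimes> w))"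
proof -
  obtain xs where xs: "set xs \<subseteq> S" "wp xs = w" "length xs = len w"
    by (rule reduced_word [OF assms(1)])
  then obtain s ys where ys: "xs = s # ys" using assms(2) by (cases xs) auto
  then have "s \<otimes> w = wp ys" "s \<in> S" using xs by auto
  then have "len (s \<otimes> w) < len w" using len_le [of ys] xs ys by simp
  then show ?thesis using that [of s] len_gen_mult [of s w] \<open>s \<in> S\<close> assms by auto
qed

text \<open>A letter put before a reduced word over \<open>J\<close> either keeps it reduced or is
  an inversion of it, and then strong exchange deletes a letter of that word.\<close>

lemma reduced_word_in:
  assumes "set xs \<subseteq> J" "J \<subseteq> S"
  shows "\<exists>ys. set ys \<subseteq> J \<and> wp ys = wp xs \<and> length ys = len (wp xs)"
  using assms
proof (induction xs)
  case (Cons s xs)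
  then obtain ys where ys: "set ys \<subseteq> J" "wp ys = wp xs" "length ys = len (wp xs)" by auto
  have s: "s \<in> S" and xsS: "set xs \<subseteq> S" and ysS: "set ys \<subseteq> S" using Cons ys by auto
  consider "len (s \<otimes> wp xs) = Suc (len (wp xs))" | "len (wp xs) = Suc (len (s \<otimes> wp xs))"
    using len_gen_mult [OF s, of "wp xs"] xsS by auto
  then show ?case
  proof cases
    case 1
    then show ?thesis using ys Cons.prems by (intro exI [of _ "s # ys"]) auto
  next
    case 2
    then have "inversion (wp ys) s"
      using inversion_iff [of s "wp xs"] gen_reflection s xsS ys by simp
    then obtain zs where "set zs \<subseteq> set ys" "Suc (length zs) = length ys" "wp zs = s \<otimes> wp ys"
      using crosses_deletion [OF ysS, of s] s inversion_wp [OF ysS, of s] by auto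
    then show ?thesis using 2 ys by (intro exI [of _ zs]) auto
  qed
qed auto

text \<open>A reduced word of a over \<open>J\<close> has a single letter, which must be a.\<close>

lemma gen_in_generate:
  assumes "J \<subseteq> S" "a \<in> S" "a \<in> generate W J" shows "a \<in> J"
proof -
  obtain xs where "set xs \<subseteq> J" "wp xs = a"
    using assms(3) by (auto simp: generate_eq_words [OF assms(1)] lists_eq_set)
  then obtain ys where ys: "set ys \<subseteq> J" "wp ys = a" "length ys = 1"
    using reduced_word_in [of xs J] assms by auto
  then obtain b where "ys = [b]" by (auto simp: length_Suc_conv)
  then show ?thesis using ys assms by auto
qed

section \<open>Bruhat order\<close>

abbreviation le :: "'a \<Rightarrow> 'a \<Rightarrow> bool" where "le \<equiv> bruhat_le W S"
abbreviation cov :: "'a \<Rightarrow> 'a \<Rightarrow> bool" where "cov \<equiv> covered_by W S"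
abbreviation step :: "('a \<times> 'a) set" where "step \<equiv> bruhat_step W S"

text \<open>The order is defined by reflections on the right, while generators act on the left
  below; conjugation by u converts between the two forms.\<close>

lemma step_iff_left:
  "(u, v) \<in> step \<longleftrightarrow> u \<in> carrier W \<and> (\<exists>t\<in>reflections W S. v = t \<otimes> u \<and> len u < len v)"
proof -
  have "\<exists>t'\<in>reflections W S. u \<otimes> t = t' \<otimes> u"
    if "t \<in> reflections W S" "u \<in> carrier W" for t
    using conj_reflection [OF that] reflection_closed [OF that(1)] that(2)
    by (intro bexI [of _ "u \<otimes> t \<otimes> inv u"]) (auto simp: m_assoc)
  moreover have "\<exists>t'\<in>reflections W S. t \<otimes> u = u \<otimes> t'"
    if "t \<in> reflections W S" "u \<in> carrier W" for t
    using conj_reflection [OF that(1), of "inv u"] reflection_closed [OF that(1)] that(2)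
    by (intro bexI [of _ "inv u \<otimes> t \<otimes> u"]) (auto simp: m_assoc)
  ultimately show ?thesis unfolding bruhat_step_def by fastforce
qed

lemma step_closed:
  assumes "(u, v) \<in> step"
  shows "u \<in> carrier W" "v \<in> carrier W" "len u < len v"
  using assms reflection_closed by (auto simp: step_iff_left)

lemma step_inv: assumes "(u, v) \<in> step" shows "(inv u, inv v) \<in> step"
proof -
  obtain t where t: "t \<in> reflections W S" "v = u \<otimes> t" "u \<in> carrier W" "len u < len v"
    using assms by (auto simp: bruhat_step_def)
  have tc: "t \<in> carrier W" using t reflection_closed by blast
  have "inv t = t" using reflection_sq [OF t(1)] tc by (simp add: inv_equality)
  then have "inv v = t \<otimes> inv u" using t tc by (simp add: inv_mult_group)
  moreover have "len (inv u) < len (inv v)" using t tc by simp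
  ultimately show ?thesis using t(1,3) by (auto simp: step_iff_left)
qed

lemma le_closed: "le x y \<Longrightarrow> x \<in> carrier W" "le x y \<Longrightarrow> y \<in> carrier W"
  by (auto simp: bruhat_le_def)

lemma le_refl: "x \<in> carrier W \<Longrightarrow> le x x"
  by (simp add: bruhat_le_def)

lemma le_trans [trans]: "le x y \<Longrightarrow> le y z \<Longrightarrow> le x z"
  by (auto simp: bruhat_le_def)

lemma step_le: "(x, y) \<in> step \<Longrightarrow> le x y"
  by (auto simp: bruhat_le_def dest: step_closed)

lemma le_induct [consumes 1, case_names refl step]:
  assumes "le x y" "P x" "\<And>y z. \<lbrakk>le x y; (y, z) \<in> step; P y\<rbrakk> \<Longrightarrow> P z"
  shows "P y"
proof -
  have xc: "x \<in> carrier W" and xy: "(x, y) \<in> step\<^sup>*" using assms(1) by (auto simp: bruhat_le_def)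
  from xy have "P y \<and> le x y"
    by (induction rule: rtrancl_induct) (use assms(2,3) xc in \<open>auto intro: le_refl le_trans step_le\<close>)
  then show ?thesis ..
qed

lemma le_len: "le x y \<Longrightarrow> x = y \<or> len x < len y"
  by (induction rule: le_induct) (auto dest: step_closed)

lemma le_eqI: "le x y \<Longrightarrow> len y \<le> len x \<Longrightarrow> x = y"
  using le_len by fastforce

lemma le_inv: assumes "le x y" shows "le (inv x) (inv y)"
  using assms
proof (induction rule: le_induct)
  case refl then show ?case using assms le_closed le_refl by blast
next
  case (step y z) then show ?case using step_inv step_le le_trans by blast
qed

section \<open>Left multiplication by a generator and the Bruhat order\<close>

lemma gen_step: "\<lbrakk>s \<in> S; w \<in> carrier W; len w < len (s \<otimes> w)\<rbrakk> \<Longrightarrow> (w, s \<otimes> w) \<in> step"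
  using gen_reflection by (auto simp: step_iff_left)

lemma gen_step_down: "\<lbrakk>s \<in> S; w \<in> carrier W; len (s \<otimes> w) < len w\<rbrakk> \<Longrightarrow> (s \<otimes> w, w) \<in> step"
  using gen_step [of s "s \<otimes> w"] by simp

text \<open>Multiplying y = tx by s replaces t by sts; by \<open>len_reflection_gen_mult\<close> the
  step keeps its direction unless t = s.\<close>

lemma step_gen:
  assumes "(x, y) \<in> step" "s \<in> S"
  shows "s \<otimes> x = y \<or> (s \<otimes> x, s \<otimes> y) \<in> step"
proof -
  obtain t where t: "t \<in> reflections W S" "y = t \<otimes> x" "x \<in> carrier W" "len x < len y"
    using assms(1) by (auto simp: step_iff_left)
  have tc: "t \<in> carrier W" using t reflection_closed by blast
  have yc: "y \<in> carrier W" using t tc by simp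
  have ty: "t \<otimes> y = x" using t tc reflection_sq [OF t(1)] by (simp add: m_assoc [symmetric])
  show ?thesis
  proof (cases "t = s")
    case False
    have "s \<otimes> t \<otimes> y = s \<otimes> x" using ty tc yc assms by (simp add: m_assoc)
    then have "len (s \<otimes> x) < len (s \<otimes> y)"
      using len_reflection_gen_mult [OF t(1) assms(2) False yc] ty t(4) by simp
    moreover have "s \<otimes> y = (s \<otimes> t \<otimes> s) \<otimes> (s \<otimes> x)"
      using t tc assms by (simp add: m_assoc)
    moreover have "s \<otimes> t \<otimes> s \<in> reflections W S" using conj_reflection [OF t(1), of s] assms by simp
    ultimately show ?thesis using t(3) assms(2) unfolding step_iff_left by auto
  qed (use t in simp)
qed

lemma le_gen:
  assumes "le x y" "s \<in> S" shows "le (s \<otimes> x) y \<or> le (s \<otimes> x) (s \<otimes> y)"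
  using assms(1)
proof (induction rule: le_induct)
  case refl then show ?case using le_refl assms le_closed by simp
next
  case (step y z)
  then show ?case using step_gen [OF step(2) assms(2)] le_trans step_le by metis
qed

text \<open>Each step from y to z of a chain either is multiplication by s, and then sz = y is
  already above x, or is carried to a step from sy to sz.\<close>

lemma le_gen_mult_right:
  assumes "le x y" "s \<in> S" "len x < len (s \<otimes> x)" shows "le x (s \<otimes> y)"
  using assms(1)
proof (induction rule: le_induct)
  case refl then show ?case using gen_step step_le assms le_closed by blast
next
  case (step y z)
  show ?case using step_gen [OF step(2) assms(2)]
  proof
    assume "s \<otimes> y = z"
    then have "s \<otimes> z = y" using step_closed [OF step(2)] assms(2) by auto
    then show ?thesis using step(1) by simp
  qed (use step le_trans step_le in blast)
qed

lemma le_gen_mult_both: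
  assumes "le x y" "s \<in> S" "len y < len (s \<otimes> y)" shows "le (s \<otimes> x) (s \<otimes> y)"
  using le_gen [OF assms(1,2)] gen_step [OF assms(2) _ assms(3)] le_closed [OF assms(1)] step_le le_trans
  by blast

lemma one_le: "w \<in> carrier W \<Longrightarrow> le \<one> w"
proof (induction "len w" arbitrary: w rule: less_induct)
  case less
  show ?case
  proof (cases "w = \<one>")
    case False
    then obtain s where s: "s \<in> S" "len w = Suc (len (s \<otimes> w))"
      using left_descent_exists less.prems by blast
    then have "le \<one> (s \<otimes> w)" using less by simp
    also have "le (s \<otimes> w) w" using s less.prems by (intro step_le gen_step_down) auto
    finally show ?thesis .
  qed (simp add: le_refl)
qed

text \<open>This makes the order graded. For a descent s of w with x not below sw, s is a descent of
  x too, and a coatom z of sw above sx yields the coatom sz of w.\<close>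

lemma coatom_above:
  assumes "le x w" "x \<noteq> w"
  shows "\<exists>z. (z, w) \<in> step \<and> len w = Suc (len z) \<and> le x z"
  using assms
proof (induction "len w" arbitrary: x w rule: less_induct)
  case less
  have xc: "x \<in> carrier W" and wc: "w \<in> carrier W" using le_closed less.prems by auto
  have "len x < len w" using less.prems le_len by blast
  then have "w \<noteq> \<one>" by auto
  then obtain s where s: "s \<in> S" "len w = Suc (len (s \<otimes> w))"
    using left_descent_exists wc by blast
  have sw: "(s \<otimes> w, w) \<in> step" using s wc by (intro gen_step_down) auto
  show ?case
  proof (cases "le x (s \<otimes> w)")
    case False
    then have len_sx: "len x = Suc (len (s \<otimes> x))"
      using le_gen_mult_right [OF less.prems(1) s(1)] len_gen_mult [OF s(1) xc] by auto
    then have "le (s \<otimes> x) w"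
      using gen_step_down [OF s(1) xc] less.prems(1) le_trans [OF step_le] by simp
    then have "le (s \<otimes> x) (s \<otimes> w)"
      using le_gen_mult_right [of "s \<otimes> x" w s] s xc len_sx by simp
    moreover have "s \<otimes> x \<noteq> s \<otimes> w" using less.prems s xc wc by simp
    ultimately obtain z where z: "(z, s \<otimes> w) \<in> step" "len (s \<otimes> w) = Suc (len z)" "le (s \<otimes> x) z"
      using less.hyps [of "s \<otimes> w" "s \<otimes> x"] s by auto
    have zc: "z \<in> carrier W" using z step_closed by blast
    have not_z: "\<not> le x z" using False z(1) le_trans step_le by blast
    then have xz: "le x (s \<otimes> z)" using le_gen [OF z(3) s(1)] s xc by simp
    have "z \<noteq> w" using z s by auto
    then have "(s \<otimes> z, w) \<in> step" using step_gen [OF z(1) s(1)] s zc wc by auto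
    \<comment> \<open>If sz were shorter than z, then x \<le> sz \<le> z, which \<open>not_z\<close>
      excludes.\<close>
    moreover have "len (s \<otimes> z) = Suc (len z)"
      using len_gen_mult [OF s(1) zc] step_le [OF gen_step_down [OF s(1) zc]] le_trans [OF xz, of z] not_z
      by auto
    ultimately show ?thesis using xz z s by auto
  qed (use sw s in auto)
qed

lemma cov_iff: "cov x y \<longleftrightarrow> le x y \<and> len y = Suc (len x)"
proof
  assume cov: "cov x y"
  then have xy: "le x y" "x \<noteq> y" by (auto simp: covered_by_def bruhat_less_def)
  then obtain z where z: "(z, y) \<in> step" "len y = Suc (len z)" "le x z"
    using coatom_above by blast
  have "x = z"
  proof (rule ccontr)
    assume "x \<noteq> z"
    moreover have "z \<noteq> y" using z by auto
    ultimately have "bruhat_less W S x z" "bruhat_less W S z y"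
      using z step_le by (auto simp: bruhat_less_def)
    with cov show False by (auto simp: covered_by_def)
  qed
  with z xy show "le x y \<and> len y = Suc (len x)" by simp
next
  assume "le x y \<and> len y = Suc (len x)"
  moreover from this have "x \<noteq> y" by auto
  moreover have "len x < len z \<and> len z < len y" if "bruhat_less W S x z" "bruhat_less W S z y" for z
    using that le_len [of x z] le_len [of z y] by (simp add: bruhat_less_def)
  ultimately show "cov x y" unfolding covered_by_def bruhat_less_def by fastforce
qed

lemma cov_step: assumes "cov x y" shows "(x, y) \<in> step"
proof -
  have "le x y" "len y = Suc (len x)" using assms by (auto simp: cov_iff)
  moreover from this have "x \<noteq> y" by auto
  ultimately obtain z where "(z, y) \<in> step" "len y = Suc (len z)" "le x z"
    using coatom_above by blast
  then show ?thesis using le_eqI [of x z] \<open>len y = Suc (len x)\<close> by simp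
qed

lemma le_coatom: "\<lbrakk>le x w; x \<noteq> w\<rbrakk> \<Longrightarrow> \<exists>z. cov z w \<and> le x z"
  using coatom_above step_le by (metis cov_iff)

lemma cov_closed: "cov x y \<Longrightarrow> x \<in> carrier W" "cov x y \<Longrightarrow> y \<in> carrier W"
  using le_closed by (auto simp: cov_iff)

lemma cov_inv: "cov x y \<Longrightarrow> cov (inv x) (inv y)"
  using le_closed le_inv by (auto simp: cov_iff)

lemma cov_gen:
  assumes "s \<in> S" "w \<in> carrier W" shows "cov w (s \<otimes> w) \<longleftrightarrow> len w < len (s \<otimes> w)"
proof
  assume less: "len w < len (s \<otimes> w)"
  then have "le w (s \<otimes> w)" using gen_step [OF assms] step_le by blast
  moreover have "len (s \<otimes> w) = Suc (len w)" using len_gen_mult [OF assms] less by linarith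
  ultimately show "cov w (s \<otimes> w)" by (simp add: cov_iff)
qed (simp add: cov_iff)

text \<open>This has the shape of axiom (iii), with left multiplication by s in the place of \<phi>;
  the main argument plays the two formulas against each other.\<close>

lemma coat_gen:
  assumes "s \<in> S" "w \<in> carrier W" "len w < len (s \<otimes> w)"
  shows "coat W S (s \<otimes> w) = {w} \<union> {s \<otimes> u | u. cov u w \<and> cov u (s \<otimes> u)}"
proof (intro equalityI subsetI)
  fix x assume "x \<in> coat W S (s \<otimes> w)"
  then have cov: "cov x (s \<otimes> w)" by (simp add: coat_def)
  have xc: "x \<in> carrier W" using cov cov_closed by blast
  show "x \<in> {w} \<union> {s \<otimes> u | u. cov u w \<and> cov u (s \<otimes> u)}"
  proof (cases "x = w")
    case False
    then have "(s \<otimes> x, w) \<in> step"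
      using step_gen [OF cov_step [OF cov] assms(1)] assms xc by auto
    moreover have "len x = len w" using cov len_gen_mult [OF assms(1,2)] assms(3) by (auto simp: cov_iff)
    ultimately have "cov (s \<otimes> x) w" "cov (s \<otimes> x) (s \<otimes> (s \<otimes> x))"
      using step_closed [of "s \<otimes> x" w] step_le [of "s \<otimes> x" w] step_le [OF gen_step_down [OF assms(1) xc]]
        len_gen_mult [OF assms(1) xc] assms xc by (auto simp: cov_iff)
    then have "\<exists>u. x = s \<otimes> u \<and> cov u w \<and> cov u (s \<otimes> u)"
      using xc assms by (intro exI [of _ "s \<otimes> x"]) auto
    then show ?thesis by blast
  qed simp
next
  fix x assume "x \<in> {w} \<union> {s \<otimes> u | u. cov u w \<and> cov u (s \<otimes> u)}"
  then show "x \<in> coat W S (s \<otimes> w)"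
  proof
    assume "x \<in> {w}" then show ?thesis using cov_gen [OF assms(1,2)] assms(3) by (simp add: coat_def)
  next
    assume "x \<in> {s \<otimes> u | u. cov u w \<and> cov u (s \<otimes> u)}"
    then obtain u where "x = s \<otimes> u" "cov u w" "cov u (s \<otimes> u)" by blast
    then show ?thesis
      using le_gen_mult_both [of u w s] assms len_gen_mult [OF assms(1,2)] by (auto simp: coat_def cov_iff)
  qed
qed

section \<open>Descents of coatoms, and distinct elements with equal coatoms\<close>

lemma coat_descent:
  assumes "s \<in> S" "cov u y" "len (s \<otimes> y) < len y" "u \<noteq> s \<otimes> y"
  shows "len (s \<otimes> u) < len u"
proof -
  \<comment> \<open>The covering of u by y is then not multiplication by s, so it is carried to a
    step from su to sy, and sy has the length of u.\<close>
  have "s \<otimes> u \<noteq> y" using assms cov_closed [OF assms(2)] by auto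
  then have "(s \<otimes> u, s \<otimes> y) \<in> step" using step_gen cov_step assms by blast
  then show ?thesis using step_closed(3) assms by (fastforce simp: cov_iff)
qed

text \<open>If s were a descent of x too, sx would be a coatom of y without s as a descent, hence
  equal to sy.\<close>

lemma coat_eq_ascent:
  assumes "coat W S x = coat W S y" "x \<noteq> y" "x \<in> carrier W" "y \<in> carrier W"
    and "s \<in> S" "len (s \<otimes> y) < len y"
  shows "len x < len (s \<otimes> x)"
proof (rule ccontr)
  assume "\<not> ?thesis"
  then have less: "len (s \<otimes> x) < len x" using len_gen_mult [of s x] assms by auto
  then have "cov (s \<otimes> x) x" using cov_gen [of s "s \<otimes> x"] assms by simp
  then have "cov (s \<otimes> x) y" using assms(1) by (auto simp: coat_def)
  then have "s \<otimes> x = s \<otimes> y" using coat_descent [of s "s \<otimes> x" y] less assms by auto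
  then show False using assms by simp
qed

lemma len_mult_gen:
  assumes "b \<in> S" "x \<in> carrier W"
  shows "len (x \<otimes> b) = Suc (len x) \<or> len x = Suc (len (x \<otimes> b))"
proof -
  have "len (x \<otimes> b) = len (b \<otimes> inv x)"
    using len_inv [of "x \<otimes> b"] assms by (simp add: inv_mult_group)
  then show ?thesis using len_gen_mult [of b "inv x"] assms by simp
qed

text \<open>Two elements with the same coatoms that differ have disjoint descent sets, and then
  deleting the last letter of any reduced word of \<open>x\<close> and prepending \<open>s\<close> gives a reduced word of
  \<open>y\<close>. Alternating between \<open>x\<close> and \<open>y\<close> turns all letters into \<open>r\<close> and \<open>s\<close>.\<close>

lemma coat_eq_right_descent:
  assumes "coat W S x = coat W S y" "x \<noteq> y" "x \<in> carrier W" "y \<in> carrier W"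
    and "s \<in> S" "len (s \<otimes> y) < len y" "b \<in> S" "len (x \<otimes> b) < len x"
  shows "y = s \<otimes> (x \<otimes> b)"
proof -
  have "x \<otimes> b \<otimes> b = x" using assms by (simp add: m_assoc)
  then have "(x \<otimes> b, x) \<in> step"
    unfolding bruhat_step_def using assms gen_reflection
    by (auto intro!: exI [of _ "x \<otimes> b"] exI [of _ b])
  moreover have len_xb: "len x = Suc (len (x \<otimes> b))" using len_mult_gen [of b x] assms by auto
  ultimately have "cov (x \<otimes> b) y" using step_le assms(1) by (auto simp: coat_def cov_iff)
  \<comment> \<open>Since sx is longer than x, cutting off b leaves sxb at least as long as
    x.\<close>
  moreover have "\<not> len (s \<otimes> (x \<otimes> b)) < len (x \<otimes> b)"
  proof -
    have "len (s \<otimes> x) \<le> Suc (len (s \<otimes> x \<otimes> b))"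
      using len_mult_gen [of b "s \<otimes> x"] assms by auto
    moreover have "len x < len (s \<otimes> x)" using coat_eq_ascent [of x y s] assms by blast
    ultimately show ?thesis using len_xb assms by (simp add: m_assoc)
  qed
  ultimately have "x \<otimes> b = s \<otimes> y" using coat_descent [of s "x \<otimes> b" y] assms by blast
  then show ?thesis using assms by simp
qed

lemma coat_eq_word_shift:
  assumes "coat W S x = coat W S y" "x \<noteq> y" "x \<in> carrier W" "y \<in> carrier W"
    and "s \<in> S" "len (s \<otimes> y) < len y"
    and "set ps \<subseteq> S" "set zs \<subseteq> S" "b \<in> S" "wp (ps @ zs @ [b]) = x"
    and "len x = Suc (length ps + length zs)"
  shows "wp ((s # ps) @ zs) = y"
proof -
  have "set ps \<subseteq> carrier W" "set zs \<subseteq> carrier W" using assms gens_closed by auto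
  then have "wp (ps @ zs) \<otimes> b = x" using assms by (simp add: m_assoc)
  then have xb: "x \<otimes> b = wp (ps @ zs)" using assms by (auto simp: m_assoc)
  have "len (wp (ps @ zs)) < len x" using len_le [of "ps @ zs"] assms by simp
  then have "y = s \<otimes> (x \<otimes> b)" using coat_eq_right_descent [of x y s b] assms xb by simp
  then show ?thesis using xb by simp
qed

lemma coat_eq_dihedral:
  assumes "coat W S x = coat W S y" "x \<noteq> y" "x \<in> carrier W" "y \<in> carrier W"
    and "s \<in> S" "len (s \<otimes> y) < len y"
  shows "\<exists>r\<in>S. r \<noteq> s \<and> y \<in> generate W {r, s}"
proof -
  have "cov (s \<otimes> y) y" using cov_gen [of s "s \<otimes> y"] assms by simp
  then have "cov (s \<otimes> y) x" using assms(1) by (auto simp: coat_def)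
  with \<open>cov (s \<otimes> y) y\<close> have len_eq: "len x = len y" and "x \<noteq> \<one>" by (auto simp: cov_iff)
  then obtain r where r: "r \<in> S" "len x = Suc (len (r \<otimes> x))"
    using left_descent_exists assms by blast
  have rs: "r \<noteq> s" using coat_eq_ascent [of x y s] assms r by auto
  \<comment> \<open>The counter j measures how much of a word of length \<open>len y\<close> already
    lies in {r, s}; at j = \<open>len y\<close> all of it does.\<close>
  define P where "P z j \<longleftrightarrow> (\<exists>ps zs. set ps \<subseteq> {r, s} \<and> set zs \<subseteq> S \<and> length ps = j \<and>
      length ps + length zs = len y \<and> wp (ps @ zs) = z)" for z j
  have shift: "P v (Suc j)"
    if "coat W S u = coat W S v" "u \<noteq> v" "u \<in> carrier W" "v \<in> carrier W" "len u = len y"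
      "q \<in> {r, s}" "len (q \<otimes> v) < len v" "P u j" "j < len y" for u v q j
  proof -
    obtain ps zs where w: "set ps \<subseteq> {r, s}" "set zs \<subseteq> S" "length ps = j"
      "length ps + length zs = len y" "wp (ps @ zs) = u" using \<open>P u j\<close> by (auto simp: P_def)
    with \<open>j < len y\<close> obtain zs' b where zs: "zs = zs' @ [b]" by (cases zs rule: rev_cases) auto
    have "q \<in> S" "set ps \<subseteq> S" using that w r assms by auto
    then have "wp ((q # ps) @ zs') = v"
      using coat_eq_word_shift [of u v q ps zs' b] that w zs by auto
    then show ?thesis unfolding P_def using w zs that
      by (intro exI [of _ "q # ps"] exI [of _ zs']) auto
  qed
  have base: "P z 0" if z: "z \<in> carrier W" "len z = len y" for z
  proof -
    obtain xs where "set xs \<subseteq> S" "wp xs = z" "length xs = len z"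
      by (rule reduced_word [OF z(1)])
    then show ?thesis unfolding P_def using z by (intro exI [of _ "[]"] exI [of _ xs]) auto
  qed
  \<comment> \<open>Passing from x to y prepends s, a descent of y, and passing from y to x prepends
    r, a descent of x; each time one unknown letter leaves on the right.\<close>
  have "j \<le> len y \<Longrightarrow> P x j \<and> P y j" for j
  proof (induction j)
    case (Suc j)
    then show ?case using shift [of x y s j] shift [of y x r j] assms r len_eq by auto
  qed (use base assms len_eq in auto)
  from this [of "len y"] obtain ps where "set ps \<subseteq> {r, s}" "wp ps = y" by (auto simp: P_def)
  then have "y \<in> generate W {r, s}"
    using generate_eq_words [of "{r, s}"] r assms by (auto simp: lists_eq_set)
  then show ?thesis using r rs by blast
qed

text \<open>A step down from v multiplies by an inversion of v, which strong exchange realises by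
  deleting a letter from a word over \<open>J\<close>.\<close>

lemma generate_down:
  assumes "le x y" "J \<subseteq> S" "y \<in> generate W J" shows "x \<in> generate W J"
proof -
  have step: "u \<in> generate W J" if uv: "(u, v) \<in> step" "v \<in> generate W J" for u v
  proof -
    obtain t where t: "t \<in> reflections W S" "v = t \<otimes> u" "u \<in> carrier W" "len u < len v"
      using uv(1) by (auto simp: step_iff_left)
    have tc: "t \<in> carrier W" using t reflection_closed by blast
    have tv: "t \<otimes> v = u" using t tc reflection_sq [OF t(1)] by (simp add: m_assoc [symmetric])
    then have "inversion v t" using inversion_iff [OF t(1), of v] t tc by simp
    moreover obtain xs where xs: "set xs \<subseteq> J" "wp xs = v"
      using uv(2) by (auto simp: generate_eq_words [OF assms(2)] lists_eq_set)
    moreover have "set xs \<subseteq> S" using xs assms by blast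
    ultimately obtain ys where "set ys \<subseteq> J" "wp ys = u"
      using crosses_deletion [of xs t] inversion_wp [of xs t] tc tv by auto
    then show ?thesis by (auto simp: generate_eq_words [OF assms(2)] lists_eq_set)
  qed
  from assms(1,3) show ?thesis
    by (induction rule: le_induct) (auto intro: step)
qed

lemma len_1_gen: assumes "w \<in> carrier W" "len w = 1" shows "w \<in> S"
proof -
  obtain xs where xs: "set xs \<subseteq> S" "wp xs = w" "length xs = len w"
    by (rule reduced_word [OF assms(1)])
  then obtain b where "xs = [b]" using assms by (auto simp: length_Suc_conv)
  then show ?thesis using xs by auto
qed

end

section \<open>Distinguished matchings\<close>

locale coxeter_matching = coxeter_group W S for W :: "('a, 'b) monoid_scheme" (structure) and S +
  fixes Q :: "'a set" and \<phi> :: "'a \<Rightarrow> 'a"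
  assumes matching: "partial_distinguished_matching W S Q \<phi>"
begin

lemma Q_closed [simp]: "u \<in> Q \<Longrightarrow> u \<in> carrier W"
  using matching by (auto simp: partial_distinguished_matching_def decreasing_def)

lemma Q_down: "u \<in> Q \<Longrightarrow> le x u \<Longrightarrow> x \<in> Q"
  using matching by (auto simp: partial_distinguished_matching_def decreasing_def)

lemma phi_mem [simp]: "u \<in> Q \<Longrightarrow> \<phi> u \<in> Q"
  using matching by (auto simp: partial_distinguished_matching_def)

lemma phi_phi [simp]: "u \<in> Q \<Longrightarrow> \<phi> (\<phi> u) = u"
  using matching by (auto simp: partial_distinguished_matching_def)

lemma phi_cov: "u \<in> Q \<Longrightarrow> cov u (\<phi> u) \<or> cov (\<phi> u) u"
  using matching by (auto simp: partial_distinguished_matching_def)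

lemma cov_phi_iff: "u \<in> Q \<Longrightarrow> cov u (\<phi> u) \<longleftrightarrow> len u < len (\<phi> u)"
  using phi_cov by (fastforce simp: cov_iff)

lemma len_phi: "u \<in> Q \<Longrightarrow> len (\<phi> u) = Suc (len u) \<or> len u = Suc (len (\<phi> u))"
  using phi_cov by (fastforce simp: cov_iff)

lemma coat_phi:
  "\<lbrakk>u \<in> Q; len u < len (\<phi> u)\<rbrakk> \<Longrightarrow>
    coat W S (\<phi> u) = {u} \<union> {\<phi> v | v. cov v u \<and> cov v (\<phi> v)}"
  using matching cov_phi_iff [of u] unfolding partial_distinguished_matching_def by blast

lemma one_mem: "w \<in> Q \<Longrightarrow> \<one> \<in> Q"
  using Q_down one_le by simp

lemma phi_one_gen: assumes "w \<in> Q" shows "\<phi> \<one> \<in> S"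
  using len_phi [OF one_mem [OF assms]] one_mem [OF assms] by (intro len_1_gen) auto

text \<open>This serves to find \<phi>(e) in a parabolic subgroup containing \<phi>(w). For a coatom
  v of w, either v < \<phi>(v) and \<phi>(v) is a coatom of \<phi>(w), or the induction hypothesis
  for \<phi>(v) gives \<phi>(e) \<le> v.\<close>

lemma phi_one_le:
  assumes "w \<in> Q" "len w < len (\<phi> w)" shows "le (\<phi> \<one>) (\<phi> w)"
  using assms
proof (induction "len w" arbitrary: w rule: less_induct)
  case less
  have cov_w: "cov w (\<phi> w)" using less.prems cov_phi_iff by simp
  show ?case
  proof (cases "w = \<one>")
    case False
    then obtain s where s: "s \<in> S" "len w = Suc (len (s \<otimes> w))"
      using left_descent_exists less.prems(1) Q_closed by blast
    define v where "v = s \<otimes> w"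
    have "cov v w" unfolding v_def using s less.prems cov_gen [of s "s \<otimes> w"] by simp
    then have vQ: "v \<in> Q" and len_v: "len v < len w" using Q_down less.prems by (auto simp: cov_iff)
    show ?thesis
    proof (cases "len v < len (\<phi> v)")
      case True
      then have "cov (\<phi> v) (\<phi> w)"
        using coat_phi [OF less.prems] \<open>cov v w\<close> cov_phi_iff [OF vQ] by (auto simp: coat_def)
      then show ?thesis using less.hyps [OF len_v vQ True] le_trans by (auto simp: cov_iff)
    next
      case False
      then have "len (\<phi> v) < len v" using len_phi [OF vQ] by auto
      then have "le (\<phi> \<one>) v" using less.hyps [of "\<phi> v"] len_v vQ by simp
      then show ?thesis using \<open>cov v w\<close> cov_w le_trans by (meson cov_iff)
    qed
  qed (use less le_refl in simp)
qed

text \<open>So s \<phi>(w) has the coatoms that axiom (iii) demands of a partner of sw. Expanding by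
  the coatom formulas for s and \<phi> in the two possible orders gives the same set once the maps
  commute on the coatoms of w.\<close>

lemma coat_gen_phi:
  assumes "w \<in> Q" "s \<in> S"
    and comm: "\<And>v. cov v w \<Longrightarrow> s \<otimes> v \<in> Q \<and> \<phi> (s \<otimes> v) = s \<otimes> \<phi> v"
    and "len w < len (s \<otimes> w)" "len w < len (\<phi> w)" "len (\<phi> w) < len (s \<otimes> \<phi> w)"
  shows "coat W S (s \<otimes> \<phi> w) =
    {s \<otimes> w} \<union> {\<phi> v | v. cov v (s \<otimes> w) \<and> cov v (\<phi> v)}" (is "_ = ?R")
proof -
  have vQ: "v \<in> Q" if "cov v w" for v using that Q_down assms(1) by (auto simp: cov_iff)
  \<comment> \<open>Both conditions say that s \<phi>(v) is longer than v by 2.\<close>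
  have same: "cov v (s \<otimes> v) \<and> cov (s \<otimes> v) (\<phi> (s \<otimes> v)) \<longleftrightarrow>
      cov v (\<phi> v) \<and> cov (\<phi> v) (s \<otimes> \<phi> v)" if "cov v w" for v
  proof -
    have Q: "v \<in> Q" "s \<otimes> v \<in> Q" "\<phi> (s \<otimes> v) = s \<otimes> \<phi> v" using that vQ comm by auto
    show ?thesis
      using Q len_phi [OF Q(1)] len_phi [OF Q(2)] len_gen_mult [OF assms(2), of v]
        len_gen_mult [OF assms(2), of "\<phi> v"] cov_phi_iff [OF Q(1)] cov_phi_iff [OF Q(2)]
        cov_gen [OF assms(2), of v] cov_gen [OF assms(2), of "\<phi> v"]
      by auto
  qed
  have cov_w: "cov w (\<phi> w)" using cov_phi_iff assms by simp
  have cov_sw: "cov v (s \<otimes> w) \<longleftrightarrow> v = w \<or> (\<exists>u. v = s \<otimes> u \<and> cov u w \<and> cov u (s \<otimes> u))" for v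
    using coat_gen [OF assms(2) Q_closed [OF assms(1)] assms(4)] by (auto simp: coat_def)
  have cov_phi: "cov v (\<phi> w) \<longleftrightarrow> v = w \<or> (\<exists>u. v = \<phi> u \<and> cov u w \<and> cov u (\<phi> u))" for v
    using coat_phi [OF assms(1,5)] by (auto simp: coat_def)
  have "coat W S (s \<otimes> \<phi> w) = {\<phi> w} \<union> {s \<otimes> u | u. cov u (\<phi> w) \<and> cov u (s \<otimes> u)}"
    using coat_gen [OF assms(2) _ assms(6)] assms(1) by simp
  also have "\<dots> = {\<phi> w, s \<otimes> w} \<union> {s \<otimes> \<phi> u | u. cov u w \<and> cov u (\<phi> u) \<and> cov (\<phi> u) (s \<otimes> \<phi> u)}"
    using cov_phi cov_gen [OF assms(2) Q_closed [OF assms(1)]] assms(4) by auto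
  also have "\<dots> = {\<phi> w, s \<otimes> w} \<union>
      {\<phi> (s \<otimes> u) | u. cov u w \<and> cov u (s \<otimes> u) \<and> cov (s \<otimes> u) (\<phi> (s \<otimes> u))}"
    using same comm by (auto; metis)
  also have "\<dots> = ?R" using cov_sw cov_w by auto
  finally show ?thesis .
qed

text \<open>Among the new elements only u lies below its partner, so \<open>coat_v\<close> is the
  one new instance of axiom (iii). It also keeps the domain decreasing: a coatom of v is u or a
  value of \<phi> on Q.\<close>

lemma extend_matching:
  assumes "u \<in> carrier W" "v \<in> carrier W" "u \<notin> Q" "v \<notin> Q" "cov u v"
    and coat_u: "coat W S u \<subseteq> Q"
    and coat_v: "coat W S v = {u} \<union> {\<phi> x | x. cov x u \<and> cov x (\<phi> x)}"
  shows "partial_distinguished_matching W S (Q \<union> {u, v}) (\<phi>(u := v, v := u))"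
proof -
  let ?p = "\<phi>(u := v, v := u)"
  have uv: "u \<noteq> v" "\<not> cov v u" using assms(5) by (auto simp: cov_iff)
  have below_u: "x \<in> Q \<union> {u}" if "le x u" for x
    using le_coatom [OF that] coat_u Q_down unfolding coat_def by blast
  have below_v: "x \<in> Q \<union> {u, v}" if "le x v" for x
  proof (cases "x = v")
    case False
    with le_coatom [OF that] obtain z where z: "le x z" "cov z v" by blast
    have "z = u \<or> (\<exists>y. z = \<phi> y \<and> cov y u)" using z(2) coat_v by (auto simp: coat_def)
    then have "z = u \<or> z \<in> Q" using coat_u phi_mem by (auto simp: coat_def)
    then show ?thesis using z(1) below_u Q_down by blast
  qed simp
  have p_Q: "?p x = \<phi> x" if "x \<in> Q" for x using that assms by auto
  have cov_Q: "x \<in> Q" if "cov x y" "y \<in> Q" for x y using that Q_down by (auto simp: cov_iff)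
  have *: "{?p x | x. cov x y \<and> cov x (?p x)} = {\<phi> x | x. cov x y \<and> cov x (\<phi> x)}"
    if "\<And>x. cov x y \<Longrightarrow> x \<in> Q" for y
    using that p_Q by (metis (no_types, lifting))
  have dec: "decreasing W S (Q \<union> {u, v})"
    unfolding decreasing_def using assms(1,2) below_u below_v Q_down by auto
  have maps: "?p \<in> Q \<union> {u, v} \<rightarrow> Q \<union> {u, v}" by auto
  have invol: "\<forall>x\<in>Q \<union> {u, v}. ?p (?p x) = x" using assms(3,4) uv p_Q phi_mem by auto
  have covs: "\<forall>x\<in>Q \<union> {u, v}. cov x (?p x) \<or> cov (?p x) x"
    using assms(3-5) uv phi_cov by auto
  have coats: "coat W S (?p x) = {x} \<union> {?p y | y. cov y x \<and> cov y (?p y)}"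
    if x: "x \<in> Q \<union> {u, v}" "cov x (?p x)" for x
  proof -
    consider "x \<in> Q" | "x = u" using x uv by auto
    then show ?thesis
    proof cases
      case 1
      then show ?thesis using coat_phi cov_phi_iff p_Q [OF 1] x(2) * cov_Q by simp
    next
      case 2
      then show ?thesis using coat_v * [of u] coat_u uv by (auto simp: coat_def subset_iff)
    qed
  qed
  show ?thesis
    unfolding partial_distinguished_matching_def
    by (intro conjI ballI impI dec maps invol [rule_format] covs [rule_format] coats)
qed

text \<open>\<open>D\<close> is the set on which commutation is assumed, and its hypothesis unites
  the two cases: for s \<noteq> \<phi>(e) it forces r = \<phi>(e), which leads to P_s, and for s =
  \<phi>(e) it admits every r, which leads to P.\<close>

lemma phi_commutes:
  assumes max: "maximal_distinguished_matching W S Q \<phi>" and s: "s \<in> S"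
    and D: "\<And>r. \<lbrakk>r \<in> S; r \<noteq> s; \<phi> \<one> \<in> {r, s}\<rbrakk> \<Longrightarrow> generate W {r, s} \<subseteq> D"
    and "w \<in> Q" "\<And>v. \<lbrakk>le v w; v \<in> D\<rbrakk> \<Longrightarrow> s \<otimes> v \<in> Q \<and> \<phi> (s \<otimes> v) = s \<otimes> \<phi> v"
  shows "s \<otimes> w \<in> Q \<and> \<phi> (s \<otimes> w) = s \<otimes> \<phi> w"
  using assms(4,5)
proof (induction "len w" arbitrary: w rule: less_induct)
  case less
  have wQ: "w \<in> Q" and wc: "w \<in> carrier W" using less.prems(1) by auto
  have comm: "s \<otimes> v \<in> Q \<and> \<phi> (s \<otimes> v) = s \<otimes> \<phi> v" if "cov v w" for v
  proof (rule less.hyps)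
    show "len v < len w" "v \<in> Q" using that Q_down wQ by (auto simp: cov_iff)
    show "s \<otimes> x \<in> Q \<and> \<phi> (s \<otimes> x) = s \<otimes> \<phi> x" if "le x v" "x \<in> D" for x
      using less.prems(2) that \<open>cov v w\<close> le_trans by (meson cov_iff)
  qed
  consider "len (s \<otimes> w) < len w" | "len (\<phi> w) < len w" | "\<phi> w = s \<otimes> w"
    | "len w < len (s \<otimes> w)" "len w < len (\<phi> w)" "\<phi> w \<noteq> s \<otimes> w"
    using len_gen_mult [OF s wc] len_phi [OF wQ] by linarith
  then show ?case
  proof cases
    case 1
    then have cov: "cov (s \<otimes> w) w" using cov_gen [of s "s \<otimes> w"] s wc by simp
    then have "s \<otimes> w \<in> Q" using Q_down wQ by (auto simp: cov_iff)
    moreover have "\<phi> w = s \<otimes> \<phi> (s \<otimes> w)" using comm [OF cov] s wc by simp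
    ultimately show ?thesis using s by simp
  next
    case 2
    then have "cov (\<phi> w) w" using phi_cov [OF wQ] by (auto simp: cov_iff)
    \<comment> \<open>The claim for the coatom \<phi>(w) reads \<phi>(s \<phi>(w)) = sw; applying
      \<phi> turns it into the claim for w.\<close>
    from comm [OF this] have "s \<otimes> \<phi> w \<in> Q" "\<phi> (s \<otimes> \<phi> w) = s \<otimes> w" using wQ by auto
    then show ?thesis using phi_phi [of "s \<otimes> \<phi> w"] phi_mem [of "s \<otimes> \<phi> w"] by simp
  next
    case 3
    then have "s \<otimes> w \<in> Q" using wQ phi_mem by metis
    moreover have "\<phi> (s \<otimes> w) = w" using 3 wQ phi_phi by metis
    ultimately show ?thesis using 3 s wc by simp
  next
    case 4
    have phiQ: "\<phi> w \<in> Q" and phic: "\<phi> w \<in> carrier W" using wQ by auto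
    \<comment> \<open>Otherwise s \<phi>(w) is a coatom of \<phi>(w) other than w, hence \<phi>(v)
      for a coatom v of w; commutation at v gives sv = w, against w < sw.\<close>
    have up: "len (\<phi> w) < len (s \<otimes> \<phi> w)"
    proof (rule ccontr)
      assume "\<not> ?thesis"
      then have "len (s \<otimes> \<phi> w) < len (\<phi> w)" using len_gen_mult [OF s phic] by auto
      then have "s \<otimes> \<phi> w \<in> coat W S (\<phi> w)"
        using cov_gen [of s "s \<otimes> \<phi> w"] s phic by (simp add: coat_def)
      moreover have "s \<otimes> \<phi> w \<noteq> w" using 4(3) gen_cancel [OF s phic] by auto
      ultimately obtain v where v: "s \<otimes> \<phi> w = \<phi> v" "cov v w"
        using coat_phi [OF wQ 4(2)] by auto
      have vQ: "v \<in> Q" using v Q_down wQ by (auto simp: cov_iff)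
      have sv: "s \<otimes> v \<in> Q" "\<phi> (s \<otimes> v) = s \<otimes> \<phi> v" using comm [OF v(2)] by auto
      then have "\<phi> (s \<otimes> v) = \<phi> w" using v(1) [symmetric] s phic by simp
      then have "s \<otimes> v = w" using sv wQ phi_phi by metis
      then have "s \<otimes> w = v" using s vQ by auto
      then show False using 4(1) v(2) by (auto simp: cov_iff)
    qed
    have coat: "coat W S (s \<otimes> \<phi> w) = {s \<otimes> w} \<union> {\<phi> v | v. cov v (s \<otimes> w) \<and> cov v (\<phi> v)}"
      using coat_gen_phi [OF wQ s comm 4(1,2) up] by blast
    have coat_sw: "coat W S (s \<otimes> w) = {w} \<union> {s \<otimes> u | u. cov u w \<and> cov u (s \<otimes> u)}"
      using coat_gen [OF s wc 4(1)] .
    have cov: "cov (s \<otimes> w) (s \<otimes> \<phi> w)" using coat by (auto simp: coat_def)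
    have swQ: "s \<otimes> w \<in> Q"
    proof (rule ccontr)
      assume not: "s \<otimes> w \<notin> Q"
      then have not': "s \<otimes> \<phi> w \<notin> Q" using Q_down cov by (auto simp: cov_iff)
      let ?Q = "Q \<union> {s \<otimes> w, s \<otimes> \<phi> w}"
      let ?p = "\<phi>(s \<otimes> w := s \<otimes> \<phi> w, s \<otimes> \<phi> w := s \<otimes> w)"
      have "partial_distinguished_matching W S ?Q ?p"
        using s wc phic not not' cov coat_sw wQ comm coat by (intro extend_matching) auto
      moreover have "matching_le Q \<phi> ?Q ?p" using not not' by (auto simp: matching_le_def)
      ultimately have "matching_le ?Q ?p Q \<phi>"
        using max by (auto simp: maximal_distinguished_matching_def)
      then show False using not by (auto simp: matching_le_def)
    qed
    \<comment> \<open>Otherwise \<phi>(sw) is a coatom of sw other than w, hence su for a coatom u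
      of w; commutation at u gives \<phi>(w) = u, against w < \<phi>(w).\<close>
    have "len (s \<otimes> w) < len (\<phi> (s \<otimes> w))"
    proof (rule ccontr)
      assume "\<not> ?thesis"
      then have "\<phi> (s \<otimes> w) \<in> coat W S (s \<otimes> w)"
        using phi_cov [OF swQ] cov_phi_iff [OF swQ] by (auto simp: coat_def)
      moreover have "\<phi> (s \<otimes> w) \<noteq> w" using 4(3) swQ phi_phi by metis
      ultimately obtain u where u: "\<phi> (s \<otimes> w) = s \<otimes> u" "cov u w" using coat_sw by auto
      have uQ: "u \<in> Q" using u Q_down wQ by (auto simp: cov_iff)
      have "s \<otimes> w = \<phi> (s \<otimes> u)" using u swQ phi_phi by metis
      also have "\<dots> = s \<otimes> \<phi> u" using comm [OF u(2)] by simp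
      finally have "w = \<phi> u" using s wc uQ by simp
      then have "\<phi> w = u" using uQ by simp
      then show False using u(2) 4(2) by (auto simp: cov_iff)
    qed
    then have coat_eq: "coat W S (\<phi> (s \<otimes> w)) = coat W S (s \<otimes> \<phi> w)"
      using coat coat_phi [OF swQ] by simp
    show ?thesis
    proof (cases "\<phi> (s \<otimes> w) = s \<otimes> \<phi> w")
      case False
      then obtain r where r: "r \<in> S" "r \<noteq> s" "s \<otimes> \<phi> w \<in> generate W {r, s}"
        using coat_eq_dihedral [OF coat_eq False _ _ s] swQ s phic up by auto
      have rs: "{r, s} \<subseteq> S" using r s by simp
      have "le (\<phi> w) (s \<otimes> \<phi> w)" using gen_step [OF s phic up] step_le by blast
      then have gen: "\<phi> w \<in> generate W {r, s}" using generate_down rs r by blast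
      have "le w (\<phi> w)" using cov_phi_iff [OF wQ] 4(2) by (simp add: cov_iff)
      then have wD: "w \<in> generate W {r, s}" using generate_down rs gen by blast
      have "\<phi> \<one> \<in> generate W {r, s}" using generate_down [OF phi_one_le [OF wQ 4(2)] rs gen] .
      then have "\<phi> \<one> \<in> {r, s}" using gen_in_generate [OF rs phi_one_gen [OF wQ]] by blast
      then have "w \<in> D" using D r wD by blast
      then show ?thesis using less.prems(2) le_refl wc by blast
    qed (use swQ in simp)
  qed
qed

end

section \<open>Invariance under inversion\<close>

context coxeter_group
begin

text \<open>The conjugate of \<phi> by inversion, an automorphism of the Bruhat order that exchanges
  left and right multiplication.\<close>

definition inv_matching :: "('a \<Rightarrow> 'a) \<Rightarrow> 'a \<Rightarrow> 'a" where
  "inv_matching \<phi> x = inv (\<phi> (inv x))"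

lemma mem_inv_image: "Q \<subseteq> carrier W \<Longrightarrow> x \<in> m_inv W ` Q \<longleftrightarrow> x \<in> carrier W \<and> inv x \<in> Q"
  by (auto simp: image_iff) (metis inv_inv)

lemma cov_inv_iff:
  assumes "x \<in> carrier W" "y \<in> carrier W" shows "cov (inv x) (inv y) \<longleftrightarrow> cov x y"
  using cov_inv [of x y] cov_inv [of "inv x" "inv y"] assms by auto

lemma partial_distinguished_matching_inv:
  assumes "partial_distinguished_matching W S Q \<phi>"
  shows "partial_distinguished_matching W S (m_inv W ` Q) (inv_matching \<phi>)"
proof -
  interpret coxeter_matching W S Q \<phi> using assms by unfold_locales
  have QW: "Q \<subseteq> carrier W" by auto
  note mem = mem_inv_image [OF QW]
  have dec: "decreasing W S (m_inv W ` Q)"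
    unfolding decreasing_def using mem le_inv le_closed Q_down by (metis subsetI)
  have maps: "inv_matching \<phi> \<in> m_inv W ` Q \<rightarrow> m_inv W ` Q"
    using QW by (auto simp: inv_matching_def)
  have invol: "\<forall>u\<in>m_inv W ` Q. inv_matching \<phi> (inv_matching \<phi> u) = u"
    by (auto simp: inv_matching_def)
  have cov_iff_inv: "cov (inv u) (inv_matching \<phi> (inv u)) \<longleftrightarrow> cov u (\<phi> u)" if "u \<in> Q" for u
    using that by (simp add: inv_matching_def cov_inv_iff)
  have covs: "\<forall>u\<in>m_inv W ` Q. cov u (inv_matching \<phi> u) \<or> cov (inv_matching \<phi> u) u"
    using phi_cov by (auto simp: inv_matching_def cov_inv_iff)
  have coats: "coat W S (inv_matching \<phi> u) =
      {u} \<union> {inv_matching \<phi> v | v. cov v u \<and> cov v (inv_matching \<phi> v)}"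
    if u: "u \<in> m_inv W ` Q" "cov u (inv_matching \<phi> u)" for u
  proof -
    obtain q where q: "u = inv q" "q \<in> Q" using u(1) by blast
    have cov_q: "cov q (\<phi> q)" using u(2) q cov_iff_inv by simp
    have coat: "cov x (\<phi> q) \<longleftrightarrow> x = q \<or> (\<exists>v. x = \<phi> v \<and> cov v q \<and> cov v (\<phi> v))" for x
      using coat_phi [OF q(2)] cov_q cov_phi_iff [OF q(2)] by (auto simp: coat_def)
    have below: "v \<in> Q" if "cov v q" for v using that q(2) Q_down by (auto simp: cov_iff)
    have eq: "inv_matching \<phi> u = inv (\<phi> q)" using q by (simp add: inv_matching_def)
    show ?thesis
    proof (intro equalityI subsetI)
      fix x assume "x \<in> coat W S (inv_matching \<phi> u)"
      then have x: "cov x (inv (\<phi> q))" by (simp add: coat_def eq)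
      then have xc: "x \<in> carrier W" using cov_closed by blast
      have "cov (inv x) (\<phi> q)" using x cov_inv [OF x] q by simp
      then consider "inv x = q" | v where "inv x = \<phi> v" "cov v q" "cov v (\<phi> v)" using coat by blast
      then show "x \<in> {u} \<union> {inv_matching \<phi> v | v. cov v u \<and> cov v (inv_matching \<phi> v)}"
      proof cases
        case 1 then show ?thesis using q xc by auto
      next
        case 2
        have "x = inv_matching \<phi> (inv v)" using 2 below xc by (metis Q_closed inv_inv inv_matching_def)
        moreover have "cov (inv v) u" using 2 q cov_inv by simp
        moreover have "cov (inv v) (inv_matching \<phi> (inv v))" using 2 below cov_iff_inv by simp
        ultimately show ?thesis by blast
      qed
    next
      fix x assume "x \<in> {u} \<union> {inv_matching \<phi> v | v. cov v u \<and> cov v (inv_matching \<phi> v)}"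
      then consider "x = u" | v where "x = inv_matching \<phi> v" "cov v u" "cov v (inv_matching \<phi> v)"
        by blast
      then show "x \<in> coat W S (inv_matching \<phi> u)"
      proof cases
        case 1 then show ?thesis using u by (simp add: coat_def)
      next
        case 2
        have vc: "v \<in> carrier W" using 2 cov_closed by blast
        have v: "cov (inv v) q" using cov_inv [OF 2(2)] q by simp
        then have "cov (inv v) (\<phi> (inv v))" using cov_iff_inv [OF below [OF v]] 2(3) vc by simp
        then have "cov (\<phi> (inv v)) (\<phi> q)" using coat v by blast
        from cov_inv [OF this] show ?thesis
          by (simp add: 2(1) coat_def eq) (simp add: inv_matching_def)
      qed
    qed
  qed
  show ?thesis
    unfolding partial_distinguished_matching_def
    by (intro conjI ballI impI dec maps invol [rule_format] covs [rule_format] coats)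
qed

text \<open>An extension of the inverted matching, inverted once more, extends \<phi>, so by
  maximality it adds nothing.\<close>

lemma maximal_distinguished_matching_inv:
  assumes max: "maximal_distinguished_matching W S Q \<phi>"
  shows "maximal_distinguished_matching W S (m_inv W ` Q) (inv_matching \<phi>)"
  unfolding maximal_distinguished_matching_def
proof (intro conjI allI impI; (elim conjE)?)
  have pdm: "partial_distinguished_matching W S Q \<phi>"
    using max by (simp add: maximal_distinguished_matching_def)
  then show "partial_distinguished_matching W S (m_inv W ` Q) (inv_matching \<phi>)"
    by (rule partial_distinguished_matching_inv)
  fix Q' \<psi>
  assume pdm': "partial_distinguished_matching W S Q' \<psi>"
    and le: "matching_le (m_inv W ` Q) (inv_matching \<phi>) Q' \<psi>"
  interpret M: coxeter_matching W S Q \<phi> using pdm by unfold_locales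
  interpret M': coxeter_matching W S Q' \<psi> using pdm' by unfold_locales
  have QW: "Q \<subseteq> carrier W" "Q' \<subseteq> carrier W" by auto
  have "matching_le Q \<phi> (m_inv W ` Q') (inv_matching \<psi>)"
    unfolding matching_le_def
  proof (intro conjI ballI subsetI)
    fix u assume u: "u \<in> Q"
    then have *: "inv u \<in> Q'" "\<psi> (inv u) = inv_matching \<phi> (inv u)"
      using le by (auto simp: matching_le_def)
    then show "u \<in> m_inv W ` Q'" using u by (simp add: mem_inv_image [OF QW(2)])
    show "inv_matching \<psi> u = \<phi> u" using u *(2) by (simp add: inv_matching_def)
  qed
  then have ext: "matching_le (m_inv W ` Q') (inv_matching \<psi>) Q \<phi>"
    using max partial_distinguished_matching_inv [OF pdm']
    by (auto simp: maximal_distinguished_matching_def)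
  show "matching_le Q' \<psi> (m_inv W ` Q) (inv_matching \<phi>)"
    unfolding matching_le_def
  proof (intro conjI ballI subsetI)
    fix u assume u: "u \<in> Q'"
    then have *: "inv u \<in> Q" "\<phi> (inv u) = inv_matching \<psi> (inv u)"
      using ext by (auto simp: matching_le_def)
    then show "u \<in> m_inv W ` Q" using u by (simp add: mem_inv_image [OF QW(1)])
    show "inv_matching \<phi> u = \<psi> u" using u *(2) by (simp add: inv_matching_def)
  qed
qed

lemma generate_inv: assumes "J \<subseteq> carrier W" "x \<in> generate W J" shows "inv x \<in> generate W J"
  using assms generate_m_inv_closed by blast

lemma maximal_matching_commutes:
  assumes max: "maximal_distinguished_matching W S Q \<phi>" and w: "w \<in> Q" and s: "s \<in> S"
    and D: "\<And>r. \<lbrakk>r \<in> S; r \<noteq> s; \<phi> \<one> \<in> {r, s}\<rbrakk> \<Longrightarrow> generate W {r, s} \<subseteq> D"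
  shows "(\<And>v. \<lbrakk>le v w; v \<in> D\<rbrakk> \<Longrightarrow> s \<otimes> v \<in> Q \<and> \<phi> (s \<otimes> v) = s \<otimes> \<phi> v) \<Longrightarrow>
      s \<otimes> w \<in> Q \<and> \<phi> (s \<otimes> w) = s \<otimes> \<phi> w"
    and "(\<And>v. \<lbrakk>le v w; v \<in> D\<rbrakk> \<Longrightarrow> v \<otimes> s \<in> Q \<and> \<phi> (v \<otimes> s) = \<phi> v \<otimes> s) \<Longrightarrow>
      w \<otimes> s \<in> Q \<and> \<phi> (w \<otimes> s) = \<phi> w \<otimes> s"
proof -
  interpret coxeter_matching W S Q \<phi>
    using max by unfold_locales (simp add: maximal_distinguished_matching_def)
  show "s \<otimes> w \<in> Q \<and> \<phi> (s \<otimes> w) = s \<otimes> \<phi> w"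
    if "\<And>v. \<lbrakk>le v w; v \<in> D\<rbrakk> \<Longrightarrow> s \<otimes> v \<in> Q \<and> \<phi> (s \<otimes> v) = s \<otimes> \<phi> v"
    using phi_commutes [OF max s D w that] .
  assume right: "\<And>v. \<lbrakk>le v w; v \<in> D\<rbrakk> \<Longrightarrow> v \<otimes> s \<in> Q \<and> \<phi> (v \<otimes> s) = \<phi> v \<otimes> s"
  let ?Q = "m_inv W ` Q" and ?p = "inv_matching \<phi>"
  note max' = maximal_distinguished_matching_inv [OF max]
  interpret I: coxeter_matching W S ?Q ?p
    using max' by unfold_locales (simp add: maximal_distinguished_matching_def)
  have QW: "Q \<subseteq> carrier W" by auto
  \<comment> \<open>As a generator, \<phi>(e) is its own inverse, so both matchings lead to the same
    dihedral subgroups.\<close>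
  have p1: "?p \<one> = \<phi> \<one>" using phi_one_gen [OF w] by (simp add: inv_matching_def)
  have "s \<otimes> inv w \<in> ?Q \<and> ?p (s \<otimes> inv w) = s \<otimes> ?p (inv w)"
  \<comment> \<open>Commutation is now assumed on the inverses of elements of \<open>D\<close>;
    since subgroups are closed under inversion, the required dihedral subgroups still lie in this
    set.\<close>
  proof (rule I.phi_commutes [OF max' s, where D = "m_inv W ` (D \<inter> carrier W)"])
    fix r assume r: "r \<in> S" "r \<noteq> s" "?p \<one> \<in> {r, s}"
    have J: "{r, s} \<subseteq> carrier W" using r s by simp
    show "generate W {r, s} \<subseteq> m_inv W ` (D \<inter> carrier W)"
    proof
      fix x assume x: "x \<in> generate W {r, s}"
      then have "inv x \<in> D" using generate_inv [OF J x] D r p1 by auto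
      moreover have "x \<in> carrier W" using generate_in_carrier [OF J x] .
      ultimately show "x \<in> m_inv W ` (D \<inter> carrier W)" by (intro image_eqI [of _ _ "inv x"]) auto
    qed
  next
    fix v assume v: "le v (inv w)" "v \<in> m_inv W ` (D \<inter> carrier W)"
    then have vc: "v \<in> carrier W" using le_closed by blast
    have le_w: "le (inv v) w" using le_inv [OF v(1)] w by simp
    have vQ: "inv v \<in> Q" using Q_down [OF w le_w] .
    from v(2) obtain d where d: "d \<in> D" "d \<in> carrier W" "v = inv d" by blast
    show "s \<otimes> v \<in> ?Q \<and> ?p (s \<otimes> v) = s \<otimes> ?p v"
    proof -
      have "inv v \<in> D" using d by simp
      from right [OF le_w this] have *: "inv v \<otimes> s \<in> Q" "\<phi> (inv v \<otimes> s) = \<phi> (inv v) \<otimes> s" by auto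
      have "inv (s \<otimes> v) = inv v \<otimes> s" using s vc by (simp add: inv_mult_group)
      then show ?thesis using * s vc vQ
        by (simp add: mem_inv_image [OF QW] inv_matching_def inv_mult_group)
    qed
  qed (use w in simp)
  moreover have "inv (s \<otimes> inv w) = w \<otimes> s" using s w by (simp add: inv_mult_group)
  ultimately have wsQ: "w \<otimes> s \<in> Q" and "inv (\<phi> (w \<otimes> s)) = s \<otimes> inv (\<phi> w)"
    using s w by (auto simp: mem_inv_image [OF QW] inv_matching_def)
  then have "inv (inv (\<phi> (w \<otimes> s))) = \<phi> w \<otimes> s" using s w by (simp add: inv_mult_group)
  then show "w \<otimes> s \<in> Q \<and> \<phi> (w \<otimes> s) = \<phi> w \<otimes> s" using wsQ by simp
qed

end

theorem proposition4p1:
  fixes W :: "('a, 'b) monoid_scheme" (structure)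
    and S Q :: "'a set" and \<phi> :: "'a \<Rightarrow> 'a" and a w s :: 'a
  assumes "coxeter_system W S"
    and "maximal_distinguished_matching W S Q \<phi>"
    and "a = \<phi> \<one>"
    and "w \<in> Q"
    and "s \<in> S"
  shows
    "(s \<noteq> a \<and>
      (\<forall>v. bruhat_le W S v w \<and> v \<in> dihedral W a s \<longrightarrow> s \<otimes> v \<in> Q \<and> \<phi> (s \<otimes> v) = s \<otimes> \<phi> v)
        \<longrightarrow> s \<otimes> w \<in> Q \<and> \<phi> (s \<otimes> w) = s \<otimes> \<phi> w) \<and>
     (s = a \<and>
      (\<forall>v. bruhat_le W S v w \<and> v \<in> dihedral_union W S a \<longrightarrow> s \<otimes> v \<in> Q \<and> \<phi> (s \<otimes> v) = s \<otimes> \<phi> v)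
        \<longrightarrow> s \<otimes> w \<in> Q \<and> \<phi> (s \<otimes> w) = s \<otimes> \<phi> w) \<and>
     (s \<noteq> a \<and>
      (\<forall>v. bruhat_le W S v w \<and> v \<in> dihedral W a s \<longrightarrow> v \<otimes> s \<in> Q \<and> \<phi> (v \<otimes> s) = \<phi> v \<otimes> s)
        \<longrightarrow> w \<otimes> s \<in> Q \<and> \<phi> (w \<otimes> s) = \<phi> w \<otimes> s) \<and>
     (s = a \<and>
      (\<forall>v. bruhat_le W S v w \<and> v \<in> dihedral_union W S a \<longrightarrow> v \<otimes> s \<in> Q \<and> \<phi> (v \<otimes> s) = \<phi> v \<otimes> s)
        \<longrightarrow> w \<otimes> s \<in> Q \<and> \<phi> (w \<otimes> s) = \<phi> w \<otimes> s)"
proof -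
  interpret coxeter_group W S
    using assms(1) by (auto simp: coxeter_group_def coxeter_group_axioms_def coxeter_system_def)
  have ne: "generate W {r, s} \<subseteq> dihedral W a s" if "s \<noteq> a" "r \<noteq> s" "\<phi> \<one> \<in> {r, s}" for r
    using that assms(3) by (auto simp: dihedral_def insert_commute)
  have eq: "generate W {r, s} \<subseteq> dihedral_union W S a" if "s = a" "r \<in> S" "r \<noteq> s" for r
    using that by (auto simp: dihedral_union_def dihedral_def)
  note commutes = maximal_matching_commutes [OF assms(2,4,5)]
  show ?thesis
    using commutes [of "dihedral W a s"] commutes [of "dihedral_union W S a"] ne eq
    by (intro conjI impI; elim conjE; simp)
qed

end
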